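(* Let $m$ and $t\ge 5$ be positive integers satisfying $\binom{t-1}{3} \le m \le \binom{t-1}{3} + \binom{t-2}{2}-3$. Let $H$ be a $3$-graph with $m$ edges. If all but one edge of $[t-1]^{(3)}$ are in $H$ and $H$ does not contain a clique of order $t-1$, then $H$ is not dense.
   Context: For a finite set $V$, $V^{(3)}$ denotes the family of all $3$-element subsets of $V$; $[n]=\{1,\dots,n\}$. A $3$-graph $G$ consists of a finite vertex set $V(G)$ and an edge set $E(G)\subseteq V(G)^{(3)}$; vertex sets are taken of the form $[n]$. $H$ is a subgraph of $G$ if $V(H)\subseteq V(G)$ and $E(H)\subseteq E(G)$. $[n]^{(3)}$ also denotes the complete $3$-graph on $[n]$. A clique of order $p$ is a complete $3$-graph on $p$ vertices; a $3$-graph contains a clique of order $p$ if it has a subgraph (on any $p$ of its vertices) that is complete. For a $3$-graph $G$ with vertex set $[n]$ and $\vec x=(x_1,\dots,x_n)\in\mathbb R^n$, let $\lambda(G,\vec x)=\sum_{e\in E(G)}\prod_{i\in e}x_i$. The Lagrangian of $G$ is $\lambda(G)=\max\{\lambda(G,\vec x): \sum_{i=1}^n x_i=1,\ x_i\ge 0 \text{ for all } i\}$ (and analogously for an arbitrary finite vertex set). A $3$-graph $G$ is dense if every proper subgraph $G'$ of $G$ satisfies $\lambda(G')<\lambda(G)$ (equivalently, no optimum weighting of $G$ has a zero coordinate). *)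

theory Defs
  imports "HOL-Analysis.Analysis" "HOL-Library.Ramsey"
begin

record 'a three_graph =
  verts :: "'a set"
  edges :: "'a set set"

definition is_three_graph :: "'a three_graph \<Rightarrow> bool" where
  "is_three_graph G \<longleftrightarrow> finite (verts G) \<and> edges G \<subseteq> nsets (verts G) 3"

definition complete_three_graph :: "'a set \<Rightarrow> 'a three_graph" where
  "complete_three_graph V = \<lparr>verts = V, edges = nsets V 3\<rparr>"

definition subgraph_of :: "'a three_graph \<Rightarrow> 'a three_graph \<Rightarrow> bool" where
  "subgraph_of H G \<longleftrightarrow>
     is_three_graph H \<and> is_three_graph G \<and> verts H \<subseteq> verts G \<and> edges H \<subseteq> edges G"

definition contains_clique :: "'a three_graph \<Rightarrow> nat \<Rightarrow> bool" where
  "contains_clique G p \<longleftrightarrow>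
     (\<exists>S. finite S \<and> card S = p \<and> subgraph_of (complete_three_graph S) G)"

definition lagrange_poly :: "'a three_graph \<Rightarrow> ('a \<Rightarrow> real) \<Rightarrow> real" where
  "lagrange_poly G x = (\<Sum>e\<in>edges G. \<Prod>i\<in>e. x i)"

(* Only the values of a weighting on V matter; its values outside V are left unconstrained. *)
definition weightings :: "'a set \<Rightarrow> ('a \<Rightarrow> real) set" where
  "weightings V = {x. (\<forall>i\<in>V. 0 \<le> x i) \<and> (\<Sum>i\<in>V. x i) = 1}"

(* The supremum is attained when the vertex set is nonempty (lemma lagrangian_attained below),
   so it is the maximum. There is no weighting of the empty set, and the value is then
   meaningless. *)
definition lagrangian :: "'a three_graph \<Rightarrow> real" where
  "lagrangian G = (SUP x\<in>weightings (verts G). lagrange_poly G x)"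

(* G' ranges over the proper subgraphs that have a Lagrangian, hence verts G' is nonempty. *)
definition dense_three_graph :: "'a three_graph \<Rightarrow> bool" where
  "dense_three_graph G \<longleftrightarrow>
     (\<forall>G'. subgraph_of G' G \<and> G' \<noteq> G \<and> verts G' \<noteq> {} \<longrightarrow> lagrangian G' < lagrangian G)"

lemma lagrangian_attained:
  assumes G: "is_three_graph G" and ne: "verts G \<noteq> {}"
  shows "\<exists>x\<in>weightings (verts G). lagrange_poly G x = lagrangian G
           \<and> (\<forall>y\<in>weightings (verts G). lagrange_poly G y \<le> lagrangian G)"
proof -
  define V where "V = verts G"
  have fin: "finite V" and sub: "\<And>e. e \<in> edges G \<Longrightarrow> e \<subseteq> V"
    using G by (auto simp: is_three_graph_def V_def nsets_def)
  define B where "B = PiE UNIV (\<lambda>i. if i \<in> V then {0..1::real} else {0})"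
  define K where "K = B \<inter> {x. (\<Sum>i\<in>V. x i) = 1}"
  have "compact B"
  proof -
    have "compactin (product_topology (\<lambda>_. euclidean) UNIV) B"
      unfolding B_def by (subst compactin_PiE) auto
    then show ?thesis by (simp add: euclidean_product_topology)
  qed
  moreover have "closed {x :: 'a \<Rightarrow> real. (\<Sum>i\<in>V. x i) = 1}"
    by (intro closed_Collect_eq continuous_intros continuous_on_product_coordinates)
  ultimately have "compact K"
    unfolding K_def by (rule compact_Int_closed)
  have KW: "K \<subseteq> weightings V"
    by (auto simp: K_def B_def weightings_def PiE_iff split: if_splits)
  have trunc: "\<exists>x\<in>K. lagrange_poly G x = lagrange_poly G y" if y: "y \<in> weightings V" for y
  proof -
    define x where "x = (\<lambda>i. if i \<in> V then y i else 0)"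
    have "y i \<le> 1" if "i \<in> V" for i
      using member_le_sum[of i V y] y that fin by (auto simp: weightings_def)
    then have "x \<in> K"
      using y by (auto simp: K_def B_def x_def weightings_def)
    moreover have "lagrange_poly G x = lagrange_poly G y"
      unfolding lagrange_poly_def
      by (intro sum.cong prod.cong) (use sub in \<open>auto simp: x_def\<close>)
    ultimately show ?thesis by blast
  qed
  obtain v where v: "v \<in> V" using ne V_def by blast
  have "(\<lambda>i. if i = v then 1 else 0) \<in> weightings V"
    using v fin by (auto simp: weightings_def)
  then have "K \<noteq> {}" using trunc by blast
  moreover have "continuous_on K (lagrange_poly G)"
    unfolding lagrange_poly_def
    by (intro continuous_on_sum continuous_on_prod
          continuous_on_subset[OF continuous_on_product_coordinates] subset_UNIV)
  ultimately obtain x where x: "x \<in> K" "\<And>y. y \<in> K \<Longrightarrow> lagrange_poly G y \<le> lagrange_poly G x"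
    using continuous_attains_sup[OF \<open>compact K\<close>] by metis
  have le: "lagrange_poly G y \<le> lagrange_poly G x" if "y \<in> weightings V" for y
    using trunc[OF that] x(2) by metis
  have "lagrangian G = lagrange_poly G x"
    unfolding lagrangian_def V_def[symmetric]
    by (rule cSup_eq_maximum) (use x KW le in auto)
  then show ?thesis
    using x KW le unfolding V_def by (metis subsetD)
qed

end

theory Submission
  imports Defs
begin

text \<open>Write \<open>k = t - 1 \<ge> 4\<close>, call the \<open>k\<close> vertices \<open>1, \<dots>, k\<close> the core \<open>A\<close> of \<open>H\<close>, let
\<open>e\<close> be the one triple of the core that is not an edge, and let \<open>F\<close> be the set of edges of \<open>H\<close>
that are not inside the core. The bound on \<open>m\<close> says that \<open>F\<close> has at most
\<open>(k - 1 choose 2) - 2\<close> elements. The core without \<open>e\<close> is a proper subgraph of \<open>H\<close>, with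
Lagrangian \<open>\<tau>\<close> say, and the theorem follows from the stronger fact that the Lagrangian of \<open>H\<close> is
at most \<open>\<tau>\<close> (\<open>near_clique_edge_weight_le\<close>): so few additional edges cannot pay for the weight
that has to be moved out of the core.

The bound is proved for all choices of \<open>A\<close>, \<open>e\<close> and \<open>F\<close> on a given vertex set at once, by
induction on the number of vertices. Having all of them in one maximisation problem is what makes
the argument work: a maximising hypergraph may be modified at will within the class, and every
modification gives an inequality. At a maximum above \<open>\<tau>\<close> the following holds.

\<^item> No weight is \<open>0\<close>, since otherwise a vertex could be deleted (\<open>positive_joint_maximum\<close>). Hence
  all partial derivatives agree (\<open>balanced_if_optimal\<close>).
\<^item> The missing triple consists of the three lightest core vertices \<open>a\<close>, \<open>b\<close>, \<open>c\<close>
  (\<open>near_clique_edge_exchange\<close>).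
\<^item> No vertex outside the core is heavier than a core vertex: otherwise exchanging the roles of the
  two would increase the weight, because an outside vertex forms edges with at least two fewer pairs
  of core vertices (\<open>near_clique_core_heaviest\<close>).
\<^item> \<open>F\<close> may be taken to be compressed: replacing a vertex of an edge in \<open>F\<close> by a heavier one gives
  another edge in \<open>F\<close>, as long as the result is not inside the core.

Now let \<open>a\<close> be the lightest core vertex, of weight \<open>z\<close>, and let \<open>w\<close> be the lightest vertex outside
the core, of weight \<open>s \<le> z\<close>. Let \<open>N\<close> be the set of vertices that form an edge together with \<open>a\<close> and
\<open>w\<close>, \<open>d\<close> its total weight, and \<open>\<beta> = x b * x c\<close>. Equality of the derivatives at \<open>a\<close> and \<open>w\<close> bounds \<open>d\<close> from
below: \<open>(z - s) * d\<close> is the weight of the pairs that form an edge with \<open>a\<close> but not with \<open>w\<close>, minus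
the weight of the pairs for which it is the other way round. Every pair of core vertices that does
not form an edge with \<open>w\<close> contributes at least \<open>\<beta>\<close>, and only the missing triple, that is the pair
\<open>b c\<close>, has to be subtracted (\<open>core_excess_ge\<close>). Equality of the derivatives at \<open>a\<close> and at a vertex
\<open>t\<close> in \<open>N\<close> bounds \<open>x t - z\<close>, hence \<open>d\<close>, from above (\<open>joint_link_excess_le\<close>). With one vertex outside
the core the two bounds contradict each other, the two missing elements of \<open>F\<close> being just enough
(\<open>one_outside_arith\<close>). With several, compression spreads the elements of \<open>F\<close> over all of them, so
that \<open>w\<close> lies in very few edges and the contradiction is coarse (\<open>many_outside_arith\<close>).\<close>

section \<open>Weights of edge sets and first-order optimality\<close>

lemma sum_nsets_insert:
  fixes \<phi> :: "'a set \<Rightarrow> real"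
  assumes "finite B" and "a \<notin> B"
  shows "(\<Sum>g\<in>nsets (insert a B) (Suc m). \<phi> g)
       = (\<Sum>g\<in>nsets B (Suc m). \<phi> g) + (\<Sum>P\<in>nsets B m. \<phi> (insert a P))"
proof -
  have "nsets (insert a B) (Suc m) = nsets B (Suc m) \<union> insert a ` nsets B m"
  proof (intro equalityI subsetI)
    fix g assume g: "g \<in> nsets (insert a B) (Suc m)"
    show "g \<in> nsets B (Suc m) \<union> insert a ` nsets B m"
    proof (cases "a \<in> g")
      case True
      then have "g - {a} \<in> nsets B m" "g = insert a (g - {a})"
        using g by (auto simp: nsets_def)
      then show ?thesis by blast
    next
      case False
      then show ?thesis using g by (auto simp: nsets_def)
    qed
  next
    fix g assume "g \<in> nsets B (Suc m) \<union> insert a ` nsets B m"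
    then show "g \<in> nsets (insert a B) (Suc m)"
      using assms by (auto simp: nsets_def card_insert_if finite_subset)
  qed
  moreover have "nsets B (Suc m) \<inter> insert a ` nsets B m = {}"
    using assms by (auto simp: nsets_def)
  moreover have "inj_on (insert a) (nsets B m)"
    using assms(2) by (auto simp: inj_on_def nsets_def insert_ident subset_iff)
  ultimately show ?thesis
    using assms by (simp add: sum.union_disjoint finite_imp_finite_nsets sum.reindex)
qed

definition edge_weight :: "'a set set \<Rightarrow> ('a \<Rightarrow> real) \<Rightarrow> real" where
  "edge_weight E x = (\<Sum>g\<in>E. prod x g)"

lemma nsets_1_sum:
  fixes \<phi> :: "'a set \<Rightarrow> real"
  shows "(\<Sum>Q\<in>nsets U (Suc 0). \<phi> Q) = (\<Sum>p\<in>U. \<phi> {p})"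
proof -
  have "nsets U (Suc 0) = (\<lambda>p. {p}) ` U"
    by (auto simp: nsets_def card_1_singleton_iff)
  then show ?thesis by (simp add: sum.reindex)
qed

text \<open>With all other weights fixed, the total weight is affine in the weight of \<open>i\<close> and in that of \<open>j\<close>;
the four terms collect the edges that contain neither, only \<open>i\<close>, only \<open>j\<close>, or both.\<close>

lemma edge_weight_split:
  fixes y :: "'a \<Rightarrow> real"
  assumes V: "finite V" "E \<subseteq> nsets V 3" and ij: "i \<in> V" "j \<in> V" "i \<noteq> j"
  defines "U \<equiv> V - {i, j}"
  shows "edge_weight E y =
      (\<Sum>g\<in>nsets U 3. of_bool (g \<in> E) * prod y g)
    + y i * (\<Sum>P\<in>nsets U 2. of_bool (insert i P \<in> E) * prod y P)
    + y j * (\<Sum>P\<in>nsets U 2. of_bool (insert j P \<in> E) * prod y P)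
    + y i * y j * (\<Sum>p\<in>U. of_bool ({i, j, p} \<in> E) * y p)"
proof -
  define \<phi> where "\<phi> g = of_bool (g \<in> E) * prod y g" for g
  have U: "finite U" "i \<notin> U" "j \<notin> U" "V = insert i (insert j U)"
    using V ij by (auto simp: U_def)
  have fin: "finite (nsets V 3)" using V(1) by (rule finite_imp_finite_nsets)
  have "edge_weight E y = (\<Sum>g\<in>nsets V 3. \<phi> g)"
    unfolding edge_weight_def \<phi>_def
    by (rule sum.mono_neutral_cong_left[OF fin V(2)]) auto
  also have "\<dots> = (\<Sum>g\<in>nsets U 3. \<phi> g) + (\<Sum>P\<in>nsets U 2. \<phi> (insert j P))
      + ((\<Sum>P\<in>nsets U 2. \<phi> (insert i P)) + (\<Sum>p\<in>U. \<phi> {i, j, p}))"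
    using U ij(3)
    by (simp add: numeral_3_eq_3 numeral_2_eq_2 sum_nsets_insert nsets_1_sum del: One_nat_def)
  finally have "edge_weight E y = (\<Sum>g\<in>nsets U 3. \<phi> g) + (\<Sum>P\<in>nsets U 2. \<phi> (insert j P))
      + ((\<Sum>P\<in>nsets U 2. \<phi> (insert i P)) + (\<Sum>p\<in>U. \<phi> {i, j, p}))" .
  moreover have "(\<Sum>p\<in>U. \<phi> {i, j, p}) = y i * y j * (\<Sum>p\<in>U. of_bool ({i, j, p} \<in> E) * y p)"
    unfolding \<phi>_def sum_distrib_left
  proof (rule sum.cong)
    fix p assume "p \<in> U"
    then have "i \<noteq> p" "j \<noteq> p" using U(2,3) by auto
    then have "prod y {i, j, p} = y i * y j * y p" using ij(3) by simp
    then show "of_bool ({i, j, p} \<in> E) * prod y {i, j, p}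
        = y i * y j * (of_bool ({i, j, p} \<in> E) * y p)" by simp
  qed simp
  moreover have "(\<Sum>P\<in>nsets U 2. \<phi> (insert l P))
      = y l * (\<Sum>P\<in>nsets U 2. of_bool (insert l P \<in> E) * prod y P)" if "l \<notin> U" for l
    unfolding \<phi>_def sum_distrib_left
  proof (rule sum.cong)
    fix P assume "P \<in> nsets U 2"
    then have "finite P" "l \<notin> P" using that by (auto simp: nsets_def)
    then show "of_bool (insert l P \<in> E) * prod y (insert l P)
        = y l * (of_bool (insert l P \<in> E) * prod y P)" by simp
  qed simp
  ultimately show ?thesis unfolding \<phi>_def[symmetric] using U(2,3) by simp
qed

text \<open>The Lagrange multiplier condition: the partial derivatives of the edge weight at any two vertices
\<open>i\<close> and \<open>j\<close> are equal. The contribution of the pairs that form an edge with both vertices has been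
cancelled, and the edges that contain both have been collected on the left.\<close>

definition balanced :: "'a set \<Rightarrow> 'a set set \<Rightarrow> ('a \<Rightarrow> real) \<Rightarrow> bool" where
  "balanced V E x \<longleftrightarrow> (\<forall>i\<in>V. \<forall>j\<in>V. i \<noteq> j \<longrightarrow>
     (x i - x j) * (\<Sum>p\<in>V - {i, j}. of_bool ({i, j, p} \<in> E) * x p)
     = (\<Sum>P\<in>nsets (V - {i, j}) 2. (of_bool (insert i P \<in> E) - of_bool (insert j P \<in> E)) * prod x P))"

text \<open>Moving a small amount \<open>\<epsilon>\<close> of weight from \<open>j\<close> to \<open>i\<close> changes the total weight by
\<open>\<epsilon> * D - \<epsilon>\<^sup>2 * B\<close>, where \<open>D\<close> is the difference of the derivatives and \<open>B\<close> the weight of the common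
link. Positive weights allow both signs of \<open>\<epsilon>\<close>, so optimality forces \<open>D = 0\<close>.\<close>

lemma balanced_if_optimal:
  fixes x :: "'a \<Rightarrow> real"
  assumes V: "finite V" "E \<subseteq> nsets V 3"
    and x: "x \<in> weightings V" and pos: "\<And>i. i \<in> V \<Longrightarrow> 0 < x i"
    and opt: "\<And>y. y \<in> weightings V \<Longrightarrow> edge_weight E y \<le> edge_weight E x"
  shows "balanced V E x"
  unfolding balanced_def
proof (intro ballI impI)
  fix i j assume ij: "i \<in> V" "j \<in> V" "i \<noteq> j"
  define U where "U = V - {i, j}"
  define A where "A l = (\<Sum>P\<in>nsets U 2. of_bool (insert l P \<in> E) * prod x P)" for l
  define B where "B = (\<Sum>p\<in>U. of_bool ({i, j, p} \<in> E) * x p)"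
  define D where "D = A i - A j - (x i - x j) * B"
  have key: "\<epsilon> * D \<le> \<epsilon>\<^sup>2 * B" if e: "\<bar>\<epsilon>\<bar> < x i" "\<bar>\<epsilon>\<bar> < x j" for \<epsilon>
  proof -
    define y where "y = x(i := x i + \<epsilon>, j := x j - \<epsilon>)"
    have yU: "y p = x p" if "p \<in> U" for p using that by (auto simp: y_def U_def)
    have sums: "sum h V = h i + h j + sum h U" for h :: "'a \<Rightarrow> real"
    proof -
      have "V = insert i (insert j U)" using ij by (auto simp: U_def)
      moreover have "finite U" "i \<notin> U" "j \<notin> U" using V(1) by (auto simp: U_def)
      ultimately show ?thesis using ij(3) by (simp del: insert_Diff_single)
    qed
    have "y \<in> weightings V"
    proof -
      have "sum y V = sum x V"
        unfolding sums using ij(3) yU by (simp add: y_def)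
      moreover have "0 \<le> y l" if "l \<in> V" for l
        using e pos[OF that] by (auto simp: y_def)
      ultimately show ?thesis using x by (auto simp: weightings_def)
    qed
    then have "edge_weight E y \<le> edge_weight E x" by (rule opt)
    moreover have "prod y g = prod x g" if "g \<subseteq> U" for g
      using that yU by (intro prod.cong) auto
    then have "(\<Sum>g\<in>nsets U 3. of_bool (g \<in> E) * prod y g)
        = (\<Sum>g\<in>nsets U 3. of_bool (g \<in> E) * prod x g)"
      "(\<Sum>P\<in>nsets U 2. of_bool (insert l P \<in> E) * prod y P) = A l" for l
      unfolding A_def by (auto intro!: sum.cong simp: nsets_def)
    moreover have "(\<Sum>p\<in>U. of_bool ({i, j, p} \<in> E) * y p) = B"
      unfolding B_def by (intro sum.cong) (auto simp: yU)
    moreover have "y i = x i + \<epsilon>" "y j = x j - \<epsilon>" using ij(3) by (auto simp: y_def)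
    ultimately have "(x i + \<epsilon>) * A i + (x j - \<epsilon>) * A j + (x i + \<epsilon>) * (x j - \<epsilon>) * B
        \<le> x i * A i + x j * A j + x i * x j * B"
      using edge_weight_split[OF V ij, of x] edge_weight_split[OF V ij, of y]
      by (simp add: U_def[symmetric] A_def[symmetric] B_def[symmetric])
    then show ?thesis unfolding D_def by (simp add: algebra_simps power2_eq_square)
  qed
  have "0 \<le> B" unfolding B_def using pos by (intro sum_nonneg) (auto simp: U_def less_imp_le)
  have "D = 0"
  proof (rule ccontr)
    assume "D \<noteq> 0"
    \<comment> \<open>Small enough to keep both weights nonnegative and to make the linear term win.\<close>
    define \<delta> where "\<delta> = min (min (x i) (x j)) (\<bar>D\<bar> / (B + 1)) / 2"
    have "0 < \<delta>" using pos ij \<open>D \<noteq> 0\<close> \<open>0 \<le> B\<close> by (auto simp: \<delta>_def)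
    moreover have "2 * \<delta> \<le> x i" "2 * \<delta> \<le> x j" "2 * \<delta> \<le> \<bar>D\<bar> / (B + 1)"
      by (auto simp: \<delta>_def)
    then have "\<delta> < x i" "\<delta> < x j" "\<delta> < \<bar>D\<bar> / (B + 1)" using \<open>0 < \<delta>\<close> by linarith+
    moreover from this have "\<delta> * (B + 1) < \<bar>D\<bar>" using \<open>0 \<le> B\<close> by (simp add: pos_less_divide_eq)
    ultimately have "(sgn D * \<delta>) * D \<le> (sgn D * \<delta>)\<^sup>2 * B"
      by (intro key) (auto simp: abs_mult abs_sgn_eq)
    then have "\<delta> * \<bar>D\<bar> \<le> \<delta> * (\<delta> * B)"
      using \<open>D \<noteq> 0\<close> by (auto simp: sgn_if power2_eq_square algebra_simps split: if_splits)
    then have "\<bar>D\<bar> \<le> \<delta> * B" using \<open>0 < \<delta>\<close> by simp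
    moreover have "\<delta> * B \<le> \<delta> * (B + 1)" using \<open>0 < \<delta>\<close> by simp
    ultimately show False using \<open>\<delta> * (B + 1) < \<bar>D\<bar>\<close> by linarith
  qed
  then have "(x i - x j) * B = A i - A j" by (simp add: D_def)
  then show "(x i - x j) * (\<Sum>p\<in>V - {i, j}. of_bool ({i, j, p} \<in> E) * x p)
     = (\<Sum>P\<in>nsets (V - {i, j}) 2. (of_bool (insert i P \<in> E) - of_bool (insert j P \<in> E)) * prod x P)"
    unfolding A_def B_def U_def by (simp add: left_diff_distrib sum_subtractf)
qed

section \<open>The two numerical contradictions\<close>

text \<open>The final contradiction for one outside vertex. Here \<open>z\<close> and \<open>s\<close> are the least core weight and the
weight of the outside vertex, \<open>\<rho>\<close> and \<open>d\<close> are the number and the total weight of the vertices that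
form an edge with both, and \<open>\<mu>\<close> is the weight of the remaining vertices. Eliminating \<open>d\<close> leaves an
inequality that is affine in \<open>\<beta>\<close>; replacing \<open>\<beta>\<close> by its least value \<open>z\<^sup>2\<close> turns it into a sum of
nonnegative terms, one of them positive, being at most \<open>0\<close>.\<close>

lemma one_outside_arith:
  fixes z s d \<rho> \<beta> \<mu> W :: real
  assumes "0 < s" "s \<le> z" "1 \<le> \<rho>" "z \<le> \<mu>" "z\<^sup>2 \<le> \<beta>"
    and W: "W = s + \<mu> + (\<rho> - 1) * z"
    and up: "(d - \<rho> * z) * W \<le> \<rho> * (\<beta> + s * \<mu>)"
    and low: "(\<rho> + 1) * \<beta> \<le> (z - s) * d"
  shows False
proof -
  have Wz: "z * \<rho> \<le> W" unfolding W using assms(1,4) by (simp add: algebra_simps)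
  moreover have "0 \<le> z * \<rho>" using assms(1-3) by simp
  ultimately have Wpos: "0 \<le> W" "z * \<rho> \<le> W" by linarith+
  have "(\<rho> + 1) * \<beta> * W \<le> (z - s) * d * W"
    using low Wpos by (intro mult_right_mono) auto
  also have "\<dots> \<le> (z - s) * (\<rho> * (\<beta> + s * \<mu>) + \<rho> * z * W)"
    using mult_left_mono[OF up, of "z - s"] assms(2) by (simp add: algebra_simps)
  finally have *: "\<beta> * ((\<rho> + 1) * W - (z - s) * \<rho>) \<le> (z - s) * (\<rho> * s * \<mu> + \<rho> * z * W)"
    by (simp add: algebra_simps)
  have "(z - s) * \<rho> \<le> (\<rho> + 1) * W"
  proof -
    have "(z - s) * \<rho> \<le> z * \<rho>" using assms by (intro mult_right_mono) auto
    also have "\<dots> \<le> W" by fact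
    also have "\<dots> \<le> (\<rho> + 1) * W" using Wpos assms(3) by (simp add: algebra_simps)
    finally show ?thesis .
  qed
  then have "z\<^sup>2 * ((\<rho> + 1) * W - (z - s) * \<rho>) \<le> \<beta> * ((\<rho> + 1) * W - (z - s) * \<rho>)"
    using assms(5) by (intro mult_right_mono) auto
  with * have "z\<^sup>2 * ((\<rho> + 1) * W - (z - s) * \<rho>) \<le> (z - s) * (\<rho> * s * \<mu> + \<rho> * z * W)"
    by linarith
  then have "z\<^sup>2 * s + z\<^sup>2 * (\<mu> - z) + s\<^sup>2 * \<rho> * z + s * \<rho> * (\<rho> - 1) * z\<^sup>2
      + \<rho> * s\<^sup>2 * \<mu> + \<rho> * s * z\<^sup>2 \<le> 0"
    unfolding W by (simp add: algebra_simps power2_eq_square)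
  moreover have "0 < z\<^sup>2 * s" using assms by auto
  moreover have "0 \<le> z\<^sup>2 * (\<mu> - z)" "0 \<le> s\<^sup>2 * \<rho> * z" "0 \<le> s * \<rho> * (\<rho> - 1) * z\<^sup>2"
    "0 \<le> \<rho> * s\<^sup>2 * \<mu>" "0 \<le> \<rho> * s * z\<^sup>2" using assms by auto
  ultimately show False by linarith
qed

text \<open>The final contradiction for \<open>q \<ge> 2\<close> outside vertices, where \<open>l\<close> is the number of core pairs that
form an edge with the lightest of them. Since \<open>q * l\<close> is less than \<open>C\<close>, at least about half of the
\<open>C\<close> pairs remain on the left of the lower bound, while \<open>3 * \<rho> \<le> l\<close> keeps the upper bound for \<open>d\<close>
below this.\<close>

lemma many_outside_arith:
  fixes z s d \<rho> \<beta> k C l q :: real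
  assumes "0 < s" "s \<le> z" "0 \<le> \<rho>" "z\<^sup>2 \<le> \<beta>" "0 \<le> d"
    and k: "4 \<le> k" and C: "C = (k - 1) * (k - 2) / 2"
    and "2 \<le> q" "q * l \<le> C - 2" "3 * \<rho> \<le> l"
    and up: "d \<le> \<rho> * (z + q * z + \<beta> / ((k - 2) * z))"
    and low: "(C - l + \<rho> - 1) * \<beta> \<le> (z - s) * d"
  shows False
proof -
  have z: "0 < z" using assms by linarith
  have \<beta>: "0 < \<beta>" using assms(4) z by (smt (verit) zero_less_power)
  have "(C - l + \<rho> - 1) * \<beta> \<le> z * d"
    using low assms(1,5) by (smt (verit) mult_right_mono)
  also have "\<dots> \<le> z * (\<rho> * (z + q * z + \<beta> / ((k - 2) * z)))"
    using up z by (intro mult_left_mono) auto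
  also have "\<dots> = \<rho> * ((1 + q) * z\<^sup>2 + \<beta> / (k - 2))"
    using z k by (simp add: field_simps power2_eq_square)
  also have "\<dots> \<le> \<rho> * ((1 + q) * \<beta> + \<beta> / (k - 2))"
    using assms by (intro mult_left_mono add_mono) auto
  also have "\<dots> = \<rho> * (1 + q + 1 / (k - 2)) * \<beta>" by (simp add: field_simps)
  finally have "C - l + \<rho> - 1 \<le> \<rho> * (1 + q + 1 / (k - 2))"
    using \<beta> by simp
  then have 1: "C - l - 1 \<le> q * \<rho> + \<rho> / (k - 2)" by (simp add: field_simps)
  have "q * (3 * \<rho>) \<le> q * l" using assms by (intro mult_left_mono) auto
  then have 2: "3 * (q * \<rho>) \<le> C - 2" using assms(9) by (simp add: mult.left_commute)
  have "2 * l \<le> q * l" using assms by (intro mult_right_mono) auto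
  then have l: "2 * l \<le> C - 2" using assms by linarith
  then have "\<rho> \<le> C / 6" using assms by linarith
  then have "\<rho> / (k - 2) \<le> C / 6 / (k - 2)" using k by (intro divide_right_mono) auto
  also have "\<dots> = (k - 1) / 12" unfolding C using k by (simp add: field_simps)
  also have "\<dots> \<le> C / 12"
    using mult_nonneg_nonneg[of "k - 1" "k - 4"] k unfolding C by (simp add: field_simps)
  finally have "\<rho> / (k - 2) \<le> C / 12" .
  moreover have "0 < C" unfolding C using k by simp
  ultimately show False using 1 2 l by linarith
qed

section \<open>No balanced weighting of a compressed near-clique\<close>

text \<open>A maximum with all the normalisations described above; it will be shown not to exist. The ranking
\<open>\<kappa>\<close> orders the core before the other vertices, and each of the two parts by decreasing weight. It
is needed because weights may coincide: the compression of \<open>F\<close> is with respect to \<open>\<kappa>\<close>, where ties are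
broken. The last three core vertices are \<open>c\<close>, \<open>b\<close>, \<open>a\<close> in this order, and \<open>w\<close> is the last
vertex of all.\<close>

locale shifted_equilibrium =
  fixes V A :: "'a set" and F :: "'a set set" and x :: "'a \<Rightarrow> real" and \<kappa> :: "'a \<Rightarrow> nat"
    and a b c w :: 'a and k :: nat
  assumes finV: "finite V" and AV: "A \<subseteq> V" and cardA: "card A = k" and k4: "4 \<le> k"
    and F: "F \<subseteq> nsets V 3 - nsets A 3" and cardF: "card F + 2 \<le> (k - 1) choose 2"
    and pos: "\<And>i. i \<in> V \<Longrightarrow> 0 < x i" and sum1: "sum x V = 1"
    and inj: "inj_on \<kappa> V"
    and anti: "\<And>i j. i \<in> V \<Longrightarrow> j \<in> V \<Longrightarrow> \<kappa> i < \<kappa> j \<Longrightarrow> x j \<le> x i"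
    and A_first: "\<And>i j. i \<in> A \<Longrightarrow> j \<in> V - A \<Longrightarrow> \<kappa> i < \<kappa> j"
    and abc: "a \<in> A" "b \<in> A" "c \<in> A" "\<kappa> c < \<kappa> b" "\<kappa> b < \<kappa> a"
    and last3: "\<And>p. p \<in> A - {a, b, c} \<Longrightarrow> \<kappa> p < \<kappa> c"
    and w: "w \<in> V - A" and w_last: "\<And>p. p \<in> V \<Longrightarrow> \<kappa> p \<le> \<kappa> w"
    and shift: "\<And>i j P. insert j P \<in> F \<Longrightarrow> j \<notin> P \<Longrightarrow> i \<notin> P \<Longrightarrow> i \<in> V \<Longrightarrow> \<kappa> i < \<kappa> j \<Longrightarrow>
      \<not> insert i P \<subseteq> A \<Longrightarrow> insert i P \<in> F"
    and bal: "balanced V (nsets A 3 - {{a, b, c}} \<union> F) x"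
begin

definition "joint_link = {t \<in> V. {a, w, t} \<in> F}"
definition "core_link = {P \<in> nsets A 2. insert w P \<in> F}"
definition "core_link_off_a = {P \<in> nsets (A - {a}) 2. insert w P \<in> F}"
text \<open>The least weight of a pair of core vertices other than \<open>a\<close>.\<close>

definition "\<beta> = x b * x c"
text \<open>The weight of the vertices that do not form an edge with \<open>a\<close> and \<open>w\<close>, apart from these two.\<close>

definition "\<mu> = 1 - x w - x a - sum x joint_link"

lemma finite_core: "finite A" using AV finV finite_subset by blast
lemma finite_joint_link: "finite joint_link" using finV by (simp add: joint_link_def)
lemma finite_F: "finite F" using F finite_imp_finite_nsets[OF finV] finite_subset by blast

lemma named_vertices: "a \<in> V" "b \<in> V" "c \<in> V" "w \<in> V" "w \<notin> A" "a \<noteq> b" "a \<noteq> c" "b \<noteq> c" "w \<noteq> a" "w \<noteq> b" "w \<noteq> c"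
  using abc AV w by auto

lemma edge_vertices: "{p, q, r} \<in> F \<Longrightarrow> p \<noteq> q \<and> p \<noteq> r \<and> q \<noteq> r \<and> p \<in> V \<and> q \<in> V \<and> r \<in> V"
proof -
  assume "{p, q, r} \<in> F"
  then have *: "{p, q, r} \<subseteq> V" "card {p, q, r} = 3" using F by (auto simp: nsets_def)
  then show ?thesis by (auto simp: card_insert_if split: if_splits)
qed

lemma shift3:
  assumes "{j, p, q} \<in> F" "i \<noteq> p" "i \<noteq> q" "i \<in> V" "\<kappa> i \<le> \<kappa> j" "\<not> {i, p, q} \<subseteq> A"
  shows "{i, p, q} \<in> F"
proof (cases "i = j")
  case False
  have "j \<in> V" "j \<noteq> p" "j \<noteq> q" using edge_vertices[OF assms(1)] by auto
  then have "\<kappa> i < \<kappa> j" using inj False assms(4,5) by (metis inj_onD le_neq_implies_less)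
  then show ?thesis using shift[of j "{p, q}" i] assms \<open>j \<noteq> p\<close> \<open>j \<noteq> q\<close> by auto
qed (use assms in auto)

lemma smallest_in_core:
  shows "p \<in> A \<Longrightarrow> x a \<le> x p" and "p \<in> A - {a} \<Longrightarrow> x b \<le> x p"
    and "p \<in> A - {a, b} \<Longrightarrow> x c \<le> x p"
proof -
  have V: "p \<in> V" if "p \<in> A" for p using that AV by blast
  have c: "x c \<le> x p" if "p \<in> A - {a, b}" for p
    using that last3[of p] anti[of p c] V named_vertices by (cases "p = c") auto
  have b: "x b \<le> x p" if "p \<in> A - {a}" for p
    using that c[of p] anti[of c b] abc named_vertices by (cases "p = b") auto
  have a: "x a \<le> x p" if "p \<in> A" for p
    using that b[of p] anti[of b a] abc named_vertices by (cases "p = a") auto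
  show "p \<in> A \<Longrightarrow> x a \<le> x p" "p \<in> A - {a} \<Longrightarrow> x b \<le> x p" "p \<in> A - {a, b} \<Longrightarrow> x c \<le> x p"
    by (fact a, fact b, fact c)
qed

lemma outside_weights: "v \<in> V - A \<Longrightarrow> x w \<le> x v" "v \<in> V - A \<Longrightarrow> x v \<le> x a"
proof -
  assume v: "v \<in> V - A"
  show "x v \<le> x a" using anti[of a v] A_first abc(1) v AV by auto
  show "x w \<le> x v"
  proof (cases "v = w")
    case False
    then have "\<kappa> v < \<kappa> w" using inj v w w_last[of v] by (metis DiffD1 inj_onD le_neq_implies_less)
    then show ?thesis using anti v w by auto
  qed simp
qed

lemma \<beta>_le: assumes "P \<in> nsets (A - {a}) 2" shows "\<beta> \<le> prod x P"
proof -
  obtain p q where pq: "P = {p, q}" "p \<in> A - {a}" "q \<in> A - {a}" "p \<noteq> q"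
    using assms by (auto simp: nsets_2_eq)
  have *: "x b * x c \<le> x p * x q" if "p \<in> A - {a}" "q \<in> A - {a, b}" for p q
    using that smallest_in_core pos AV by (intro mult_mono) (auto simp: subset_iff less_imp_le named_vertices)
  then show ?thesis using pq *[of p q] *[of q p] by (auto simp: \<beta>_def mult.commute)
qed

lemma \<beta>_pos: "0 < \<beta>" "(x a)\<^sup>2 \<le> \<beta>"
proof -
  show "0 < \<beta>" using pos named_vertices by (simp add: \<beta>_def)
  show "(x a)\<^sup>2 \<le> \<beta>" unfolding \<beta>_def power2_eq_square
    using smallest_in_core(1) abc pos named_vertices by (intro mult_mono) (auto simp: less_imp_le)
qed

lemma card_core_pairs_with_w: "card (insert w ` nsets (A - {a}) 2) = (k - 1) choose 2"
proof -
  have "inj_on (insert w) (nsets (A - {a}) 2)"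
    using named_vertices by (auto simp: inj_on_def nsets_def insert_ident subset_iff)
  then show ?thesis using finite_core abc cardA by (simp add: card_image card_nsets)
qed

text \<open>By compression, the edge \<open>a w c\<close> would make \<open>w\<close> form an edge with every pair of core vertices other
than \<open>a\<close>, and these are more than \<open>F\<close> has elements.\<close>

lemma a_w_c_not_edge: "{a, w, c} \<notin> F"
proof
  assume 0: "{a, w, c} \<in> F"
  have *: "{p, q, w} \<in> F" if pq: "p \<in> A - {a, b}" "q \<in> A - {a}" "p \<noteq> q" for p q
  proof -
    have p: "p \<in> V" "p \<noteq> w" "q \<in> V" "q \<noteq> w" using pq AV named_vertices by auto
    have "\<kappa> p \<le> \<kappa> c" using last3[of p] pq by (cases "p = c") auto
    then have "{p, a, w} \<in> F"
      using shift3[of c a w p] 0 p pq named_vertices by (auto simp: insert_commute)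
    moreover have "\<kappa> q \<le> \<kappa> a" using last3[of q] pq abc by (cases "q = b \<or> q = c") auto
    ultimately have "{q, p, w} \<in> F"
      using shift3[of a p w q] p pq named_vertices by (auto simp: insert_commute)
    then show ?thesis by (simp add: insert_commute)
  qed
  have "insert w ` nsets (A - {a}) 2 \<subseteq> F"
  proof
    fix g assume "g \<in> insert w ` nsets (A - {a}) 2"
    then obtain p q where "g = {w, p, q}" "p \<in> A - {a}" "q \<in> A - {a}" "p \<noteq> q"
      by (auto simp: nsets_2_eq)
    then show "g \<in> F" using *[of p q] *[of q p] by (cases "p = b") (auto simp: insert_commute)
  qed
  then have "(k - 1) choose 2 \<le> card F" using card_core_pairs_with_w finite_F card_mono by metis
  then show False using cardF by simp
qed

text \<open>A vertex that does not come before \<open>c\<close> could be replaced by \<open>c\<close>, which \<open>a_w_c_not_edge\<close> excludes. So the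
joint link of \<open>a\<close> and \<open>w\<close> stays inside the core and away from the missing triple.\<close>

lemma joint_link_subset: "joint_link \<subseteq> A - {a, b, c}"
proof
  fix t assume "t \<in> joint_link"
  then have t: "t \<in> V" "{a, w, t} \<in> F" by (auto simp: joint_link_def)
  have ne: "t \<noteq> a" "t \<noteq> w" using edge_vertices[OF t(2)] by auto
  have "\<kappa> t < \<kappa> c"
  proof (rule ccontr)
    assume "\<not> \<kappa> t < \<kappa> c"
    then have "{c, a, w} \<in> F" using shift3[of t a w c] t named_vertices by (auto simp: insert_commute)
    then show False using a_w_c_not_edge by (simp add: insert_commute)
  qed
  moreover have "t \<in> A" using A_first[of c t] t \<open>\<kappa> t < \<kappa> c\<close> abc by (meson DiffI less_asym)
  ultimately show "t \<in> A - {a, b, c}" using abc by auto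
qed

lemma card_core_link: "card core_link = card core_link_off_a + card joint_link"
proof -
  have "core_link = core_link_off_a \<union> (\<lambda>t. {a, t}) ` joint_link"
  proof (intro equalityI subsetI)
    fix P assume "P \<in> core_link"
    then obtain p q where pq: "P = {p, q}" "p \<in> A" "q \<in> A" "p \<noteq> q" "{w, p, q} \<in> F"
      by (auto simp: core_link_def nsets_2_eq)
    show "P \<in> core_link_off_a \<union> (\<lambda>t. {a, t}) ` joint_link"
    proof (cases "a \<in> P")
      case True
      then obtain t where "P = {a, t}" "t \<in> A" using pq by auto
      then show ?thesis using \<open>P \<in> core_link\<close> AV by (auto simp: joint_link_def core_link_def insert_commute)
    next
      case False
      then show ?thesis using pq by (auto simp: core_link_off_a_def)
    qed
  next
    fix P assume "P \<in> core_link_off_a \<union> (\<lambda>t. {a, t}) ` joint_link"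
    then show "P \<in> core_link"
      using joint_link_subset abc by (auto simp: core_link_def core_link_off_a_def joint_link_def insert_commute nsets_def)
  qed
  moreover have "core_link_off_a \<inter> (\<lambda>t. {a, t}) ` joint_link = {}" by (auto simp: core_link_off_a_def nsets_def)
  moreover have "finite core_link_off_a" using finite_core by (simp add: core_link_off_a_def finite_imp_finite_nsets)
  moreover have "inj_on (\<lambda>t. {a, t}) joint_link" by (auto simp: inj_on_def doubleton_eq_iff)
  ultimately show ?thesis by (simp add: card_Un_disjoint finite_joint_link card_image)
qed

lemma finite_core_link: "finite core_link" using finite_core by (simp add: core_link_def finite_imp_finite_nsets)

text \<open>Since \<open>w\<close> is the last vertex, compression copies its edges to every vertex outside the core.\<close>

lemma outside_card_core_link: "card (V - A) * card core_link \<le> card F"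
proof -
  let ?h = "\<lambda>(v, P). insert v P"
  have "inj_on ?h ((V - A) \<times> core_link)"
  proof (rule inj_onI, clarify)
    fix v P v' P' assume h: "v \<in> V" "v \<notin> A" "P \<in> core_link" "v' \<in> V" "v' \<notin> A" "P' \<in> core_link"
      "insert v P = insert v' P'"
    then have "P \<subseteq> A" "P' \<subseteq> A" by (auto simp: core_link_def nsets_def)
    then have "v = v'" using h by blast
    moreover have "P = P'" using h \<open>P \<subseteq> A\<close> \<open>P' \<subseteq> A\<close> \<open>v = v'\<close>
      by (metis insert_ident subset_iff)
    ultimately show "v = v' \<and> P = P'" by simp
  qed
  moreover have "?h ` ((V - A) \<times> core_link) \<subseteq> F"
  proof clarify
    fix v P assume h: "v \<in> V" "v \<notin> A" "P \<in> core_link"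
    then obtain p q where pq: "P = {p, q}" "p \<in> A" "q \<in> A" "p \<noteq> q" "{w, p, q} \<in> F"
      by (auto simp: core_link_def nsets_2_eq)
    then show "insert v P \<in> F" using shift3[of w p q v] h w_last by auto
  qed
  ultimately have "card ((V - A) \<times> core_link) \<le> card F" using finite_F by (metis card_inj_on_le)
  then show ?thesis by (simp add: card_cartesian_product)
qed

text \<open>If \<open>t\<close> forms an edge with \<open>a\<close> and \<open>w\<close>, then it also forms one with \<open>b\<close> and \<open>w\<close> and with \<open>c\<close> and \<open>w\<close>.\<close>

lemma three_card_joint_link: "3 * card joint_link \<le> card core_link"
proof -
  let ?h = "\<lambda>(t, u). {t, u}"
  have "inj_on ?h (joint_link \<times> {a, b, c})"
    using joint_link_subset by (auto simp: inj_on_def doubleton_eq_iff)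
  moreover have "?h ` (joint_link \<times> {a, b, c}) \<subseteq> core_link"
  proof
    fix P assume "P \<in> ?h ` (joint_link \<times> {a, b, c})"
    then obtain t u where tu: "P = {t, u}" "t \<in> joint_link" "u \<in> {a, b, c}" by auto
    have t: "t \<in> A" "t \<notin> {a, b, c}" "t \<in> V" using joint_link_subset tu AV by auto
    have "\<kappa> u \<le> \<kappa> a" using abc tu by auto
    then have "{u, w, t} \<in> F"
      using shift3[of a w t u] tu named_vertices t by (auto simp: joint_link_def)
    then show "P \<in> core_link" using tu t abc by (auto simp: core_link_def insert_commute)
  qed
  ultimately have "card (joint_link \<times> {a, b, c}) \<le> card core_link" using finite_core_link by (metis card_inj_on_le)
  then show ?thesis using named_vertices by (simp add: card_cartesian_product)
qed


text \<open>The derivatives at \<open>a\<close> and \<open>w\<close> are compared pair by pair. A pair that is not inside the core favours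
\<open>a\<close>, by compression. A pair inside the core forms an edge with \<open>a\<close> unless it is \<open>b c\<close>, so it
contributes its weight, at least \<open>\<beta>\<close>, if it does not form an edge with \<open>w\<close>; the exception \<open>b c\<close>
costs \<open>\<beta>\<close> once.\<close>

lemma core_excess_ge: "(real ((k - 1) choose 2) - card core_link_off_a - 1) * \<beta> \<le> (x a - x w) * sum x joint_link"
proof -
  let ?E = "nsets A 3 - {{a, b, c}} \<union> F"
  let ?U = "V - {a, w}"
  let ?B = "nsets (A - {a}) 2"
  have inE: "insert w P \<in> ?E \<longleftrightarrow> insert w P \<in> F" for P
    using named_vertices by (auto simp: nsets_def)
  have finB: "finite ?B" using finite_core by (simp add: finite_imp_finite_nsets)
  have finU: "finite (nsets ?U 2)" using finV by (simp add: finite_imp_finite_nsets)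
  have "joint_link \<subseteq> ?U" using joint_link_subset AV named_vertices by auto
  have inE': "{a, w, p} \<in> ?E \<longleftrightarrow> {a, w, p} \<in> F" for p using inE[of "{a, p}"] by (simp add: insert_commute)
  have "(\<Sum>p\<in>?U. of_bool ({a, w, p} \<in> ?E) * x p) = sum x joint_link"
    unfolding inE'
    by (rule sum.mono_neutral_cong_right) (use finV \<open>joint_link \<subseteq> ?U\<close> in \<open>auto simp: joint_link_def\<close>)
  then have eq: "(x a - x w) * sum x joint_link
      = (\<Sum>P\<in>nsets ?U 2. (of_bool (insert a P \<in> ?E) - of_bool (insert w P \<in> F)) * prod x P)"
    using bal[unfolded balanced_def, rule_format, of a w] named_vertices by (simp add: inE del: Un_iff)
  \<comment> \<open>A lower bound for the summand; for the pair \<open>b c\<close> it is exact whether or not \<open>w b c\<close> is an edge.\<close>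
  define g where "g P = (if P \<in> ?B then (if insert w P \<in> F then 0 else prod x P)
      - (if P = {b, c} then \<beta> else 0) else 0)" for P
  have "sum g (nsets ?U 2)
      \<le> (\<Sum>P\<in>nsets ?U 2. (of_bool (insert a P \<in> ?E) - of_bool (insert w P \<in> F)) * prod x P)"
  proof (rule sum_mono)
    fix P assume P: "P \<in> nsets ?U 2"
    then have P': "finite P" "card P = 2" "P \<subseteq> V" "a \<notin> P" "w \<notin> P" by (auto simp: nsets_def)
    have pP: "0 \<le> prod x P" using P'(3) pos by (intro prod_nonneg) (auto simp: less_imp_le)
    show "g P \<le> (of_bool (insert a P \<in> ?E) - of_bool (insert w P \<in> F)) * prod x P"
    proof (cases "P \<subseteq> A")
      case True
      then have 1: "P \<in> ?B" using P' by (auto simp: nsets_def)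
      have 2: "insert a P \<in> nsets A 3" using True P' abc by (auto simp: nsets_def)
      have 3: "insert a P = {a, b, c} \<longleftrightarrow> P = {b, c}"
        using P'(4) named_vertices(6,7) by (metis insert_ident insertE singletonD)
      have "insert a P \<in> ?E \<longleftrightarrow> P \<noteq> {b, c}" using 2 3 F by auto
      then show ?thesis using 1 named_vertices by (auto simp: g_def \<beta>_def)
    next
      case False
      then have "P \<notin> ?B" by (auto simp: nsets_def)
      moreover have "insert a P \<in> F" if "insert w P \<in> F"
        by (rule shift[OF that]) (use P' False named_vertices A_first[of a w] abc w in auto)
      ultimately show ?thesis using pP by (auto simp: g_def)
    qed
  qed
  moreover have "sum g (nsets ?U 2) = sum g ?B"
    by (rule sum.mono_neutral_right[OF finU]) (use AV named_vertices in \<open>auto simp: g_def nsets_def\<close>)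
  moreover have "sum g ?B = (\<Sum>P\<in>?B. if insert w P \<in> F then 0 else prod x P)
      - (\<Sum>P\<in>?B. if P = {b, c} then \<beta> else 0)"
    unfolding sum_subtractf[symmetric] by (intro sum.cong) (auto simp: g_def)
  moreover have "(\<Sum>P\<in>?B. if P = {b, c} then \<beta> else 0) = \<beta>"
    using finB abc named_vertices by (subst sum.delta) auto
  moreover have "(\<Sum>P\<in>?B. if insert w P \<in> F then 0 else prod x P) = sum (prod x) (?B - core_link_off_a)"
    by (rule sum.mono_neutral_cong_right[OF finB]) (auto simp: core_link_off_a_def)
  moreover have "real (card (?B - core_link_off_a)) * \<beta> \<le> sum (prod x) (?B - core_link_off_a)"
    using \<beta>_le by (intro sum_bounded_below) auto
  moreover have "real (card (?B - core_link_off_a)) = real ((k - 1) choose 2) - card core_link_off_a"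
  proof -
    have "core_link_off_a \<subseteq> ?B" by (auto simp: core_link_off_a_def)
    moreover from this have "card core_link_off_a \<le> card ?B" using finB card_mono by blast
    moreover have "card ?B = (k - 1) choose 2" using finite_core abc cardA by (simp add: card_nsets)
    ultimately show ?thesis using finB by (simp add: card_Diff_subset finite_subset of_nat_diff)
  qed
  ultimately show ?thesis using eq by (simp add: left_diff_distrib)
qed

text \<open>The vertices \<open>t\<close> and \<open>a\<close> form an edge with every third vertex, which gives the factor
\<open>1 - x a - x t\<close>. A pair that forms an edge with \<open>t\<close> but not with \<open>a\<close> is either \<open>b c\<close>, or it contains
an outside vertex \<open>v\<close>. In the latter case its other vertex is not in the joint link of \<open>a\<close> and \<open>w\<close>,
because otherwise \<open>w\<close> could be replaced by \<open>v\<close>; hence these pairs weigh at most \<open>x v * \<mu>\<close> for each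
\<open>v\<close>.\<close>

lemma joint_link_excess_le:
  assumes t: "t \<in> joint_link"
  shows "(x t - x a) * (1 - x a - x t) \<le> \<beta> + sum x (V - A) * \<mu>"
proof -
  let ?E = "nsets A 3 - {{a, b, c}} \<union> F"
  let ?U = "V - {t, a}"
  define Z where "Z = {P \<in> nsets (V - joint_link - {a}) 2. \<not> P \<subseteq> A}"
  define D where "D = (SIGMA v:V - A. V - joint_link - {a, v})"
  have tA: "t \<in> A" "t \<in> V" "t \<noteq> a" "t \<noteq> b" "t \<noteq> c" "t \<noteq> w" using joint_link_subset t AV named_vertices by auto
  have taw: "{a, w, t} \<in> F" using t by (simp add: joint_link_def)
  have finU: "finite (nsets ?U 2)" using finV by (simp add: finite_imp_finite_nsets)
  have pP: "0 \<le> prod x P" if "P \<subseteq> V" for P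
    using that pos by (intro prod_nonneg) (auto simp: less_imp_le)
  have "{t, a, p} \<in> ?E" if p: "p \<in> ?U" for p
  proof (cases "p \<in> A")
    case True
    then have "{t, a, p} \<in> nsets A 3" using tA abc p by (auto simp: nsets_def)
    moreover have "{t, a, p} \<noteq> {a, b, c}" using tA by auto
    ultimately show ?thesis by blast
  next
    case False
    then have "{p, a, t} \<in> F"
      using shift3[of w a t p] taw p w_last[of p] by (auto simp: insert_commute)
    then show ?thesis by (simp add: insert_commute)
  qed
  then have "(\<Sum>p\<in>?U. of_bool ({t, a, p} \<in> ?E) * x p) = sum x ?U"
    by (intro sum.cong) auto
  also have "\<dots> = 1 - x a - x t"
    using sum1 finV tA named_vertices by (simp add: sum_diff)
  finally have eq: "(x t - x a) * (1 - x a - x t)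
      = (\<Sum>P\<in>nsets ?U 2. (of_bool (insert t P \<in> ?E) - of_bool (insert a P \<in> ?E)) * prod x P)"
    using bal[unfolded balanced_def, rule_format, of t a] named_vertices tA by (simp del: Un_iff)
  have "\<dots> \<le> (\<Sum>P\<in>nsets ?U 2. (if P = {b, c} then \<beta> else 0) + (if P \<in> Z then prod x P else 0))"
  proof (rule sum_mono)
    fix P assume P: "P \<in> nsets ?U 2"
    then have P': "finite P" "card P = 2" "P \<subseteq> V" "a \<notin> P" "t \<notin> P" by (auto simp: nsets_def)
    show "(of_bool (insert t P \<in> ?E) - of_bool (insert a P \<in> ?E)) * prod x P
        \<le> (if P = {b, c} then \<beta> else 0) + (if P \<in> Z then prod x P else 0)"
    proof (cases "P = {b, c}")
      case True
      then show ?thesis using pP[OF P'(3)] named_vertices by (auto simp: \<beta>_def)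
    next
      case False
      have "insert a P \<in> ?E \<or> P \<in> Z" if tP: "insert t P \<in> ?E"
      proof (cases "P \<subseteq> A")
        case True
        then have "insert a P \<in> nsets A 3" using P' abc by (auto simp: nsets_def)
        moreover have "insert a P \<noteq> {a, b, c}"
          using P'(4) named_vertices(6,7) False by (metis insert_ident insertE singletonD)
        ultimately show ?thesis by blast
      next
        case notA: False
        have "P \<inter> joint_link = {}" if "insert a P \<notin> F"
        proof (rule ccontr)
          assume "P \<inter> joint_link \<noteq> {}"
          then obtain p where p: "p \<in> P" "p \<in> joint_link" by blast
          have "card (P - {p}) = 1" using P' p by simp
          then obtain v where "P - {p} = {v}" by (auto simp: card_1_singleton_iff)
          then have v: "P = {p, v}" "v \<noteq> p" using p by auto
          have "p \<in> A" using p joint_link_subset by auto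
          then have "v \<in> V - A" using v notA P' by auto
          then have "{v, a, p} \<in> F"
            using shift3[of w a p v] p w_last[of v] v abc by (auto simp: joint_link_def insert_commute)
          then show False using that v by (simp add: insert_commute)
        qed
        then show ?thesis using notA P' by (auto simp: Z_def nsets_def)
      qed
      then show ?thesis using False pP[OF P'(3)] by (auto simp del: Un_iff)
    qed
  qed
  also have "\<dots> = (\<Sum>P\<in>nsets ?U 2. if P = {b, c} then \<beta> else 0) + (\<Sum>P\<in>nsets ?U 2. if P \<in> Z then prod x P else 0)"
    by (rule sum.distrib)
  also have "(\<Sum>P\<in>nsets ?U 2. if P = {b, c} then \<beta> else 0) = \<beta>"
    using finU named_vertices tA by (subst sum.delta) auto
  also have "(\<Sum>P\<in>nsets ?U 2. if P \<in> Z then prod x P else 0) = sum (prod x) Z"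
    using t by (intro sum.mono_neutral_cong_right[OF finU]) (auto simp: Z_def nsets_def)
  also have "sum (prod x) Z \<le> sum (prod x) ((\<lambda>(v, p). {v, p}) ` D)"
  proof (rule sum_mono2)
    show "Z \<subseteq> (\<lambda>(v, p). {v, p}) ` D"
    proof
      fix P assume P: "P \<in> Z"
      then obtain p q where pq: "P = {p, q}" "p \<in> V - joint_link - {a}" "q \<in> V - joint_link - {a}" "p \<noteq> q"
        by (auto simp: Z_def nsets_2_eq)
      then have "(p, q) \<in> D \<or> (q, p) \<in> D" using P by (auto simp: Z_def D_def)
      then show "P \<in> (\<lambda>(v, p). {v, p}) ` D" using pq(1) by (force simp: insert_commute)
    qed
  qed (use finV in \<open>auto simp: D_def intro!: pP\<close>)
  also have "\<dots> \<le> sum (prod x \<circ> (\<lambda>(v, p). {v, p})) D"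
    by (rule sum_image_le) (use finV in \<open>auto simp: D_def intro!: pP\<close>)
  also have "\<dots> = (\<Sum>(v, p)\<in>D. x v * x p)"
  proof (rule sum.cong, simp, clarify)
    fix v p assume "(v, p) \<in> D"
    then have "v \<noteq> p" by (auto simp: D_def)
    then show "(prod x \<circ> (\<lambda>(v, p). {v, p})) (v, p) = x v * x p" by simp
  qed
  also have "\<dots> = (\<Sum>v\<in>V - A. \<Sum>p\<in>V - joint_link - {a, v}. x v * x p)"
    unfolding D_def by (rule sum.Sigma[symmetric]) (use finV in auto)
  also have "\<dots> \<le> (\<Sum>v\<in>V - A. x v * \<mu>)"
  proof (rule sum_mono)
    fix v assume v: "v \<in> V - A"
    have v': "v \<notin> joint_link" "v \<noteq> a" using v joint_link_subset abc by auto
    \<comment> \<open>The partner of \<open>v\<close> avoids the joint link, \<open>a\<close> and \<open>v\<close>; here \<open>x w \<le> x v\<close> gives the bound by \<open>\<mu>\<close>.\<close>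
    have "(\<Sum>p\<in>V - joint_link - {a, v}. x v * x p) = x v * sum x (V - (joint_link \<union> {a, v}))"
      by (simp add: sum_distrib_left set_diff_eq) (rule sum.cong, auto)
    also have "sum x (V - (joint_link \<union> {a, v})) = 1 - sum x (joint_link \<union> {a, v})"
      using sum1 finV v named_vertices joint_link_subset AV by (subst sum_diff) auto
    also have "sum x (joint_link \<union> {a, v}) = sum x joint_link + (x a + x v)"
      using v' joint_link_subset finite_joint_link by (subst sum.union_disjoint) auto
    also have "x v * (1 - (sum x joint_link + (x a + x v))) \<le> x v * \<mu>"
      using outside_weights(1)[OF v] pos[of v] v by (intro mult_left_mono) (auto simp: \<mu>_def)
    finally show "(\<Sum>p\<in>V - joint_link - {a, v}. x v * x p) \<le> x v * \<mu>" .
  qed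
  also have "\<dots> = sum x (V - A) * \<mu>" by (simp add: sum_distrib_right)
  finally show ?thesis using eq by linarith
qed


text \<open>Summing \<open>joint_link_excess_le\<close> over the joint link bounds its weight from above, against
\<open>core_excess_ge\<close>. With a single outside vertex the factor \<open>1 - x a - x t\<close> has to be kept almost
exactly; otherwise it is enough that it is at least \<open>\<mu>\<close> and at least \<open>k - 2\<close> times the least core
weight.\<close>

lemma contradiction: False
proof -
  define C where "C = real ((k - 1) choose 2)"
  define \<rho> where "\<rho> = real (card joint_link)"
  define d where "d = sum x joint_link"
  define S where "S = sum x (V - A)"
  define l where "l = real (card core_link)"
  define q where "q = card (V - A)"
  have C: "C = (real k - 1) * (real k - 2) / 2"
    using k4 by (simp add: C_def choose_two real_of_nat_div of_nat_diff)
  have F: "real (card F) \<le> C - 2" using cardF unfolding C_def by linarith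
  have s: "0 < x w" "x w \<le> x a" using pos named_vertices outside_weights(2)[of w] w by auto
  have xN: "x a \<le> x t" "0 \<le> x t" if "t \<in> joint_link" for t
    using smallest_in_core(1)[of t] that joint_link_subset pos[of t] AV by auto
  have \<rho>d: "\<rho> * x a \<le> d" unfolding \<rho>_def d_def using xN by (intro sum_bounded_below) auto
  have low': "(C - l + \<rho> - 1) * \<beta> \<le> (x a - x w) * d"
    using core_excess_ge card_core_link by (simp add: C_def l_def \<rho>_def d_def algebra_simps)
  have "0 < q" using w finV by (auto simp: q_def card_gt_0_iff)
  have ql: "real q * l \<le> C - 2"
    using outside_card_core_link F unfolding q_def l_def by (metis of_nat_mult of_nat_mono order_trans)
  have up': "(x t - x a) * (1 - x a - x t) \<le> \<beta> + S * \<mu>" if "t \<in> joint_link" for t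
    using joint_link_excess_le[OF that] by (simp add: S_def)
  have sumR: "1 = sum x (V - R) + sum x R" if "R \<subseteq> V" for R
    using sum.subset_diff[OF that finV, of x] sum1 by simp
  show False
  proof (cases "q = 1")
    case True
    then obtain v where "V - A = {v}" by (auto simp: q_def card_1_singleton_iff)
    then have Vw: "V - A = {w}" using w by auto
    then have S: "S = x w" by (simp add: S_def)
    have "l \<le> C - 2" using ql True by simp
    then have "(\<rho> + 1) * \<beta> \<le> (C - l + \<rho> - 1) * \<beta>"
      using \<beta>_pos by (intro mult_right_mono) auto
    with low' have low1: "(\<rho> + 1) * \<beta> \<le> (x a - x w) * d" by linarith
    have "joint_link \<noteq> {}"
    proof
      assume "joint_link = {}"
      then show False using low1 \<beta>_pos by (simp add: \<rho>_def d_def)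
    qed
    then have "1 \<le> card joint_link" using finite_joint_link by (simp add: Suc_le_eq card_gt_0_iff)
    then have \<rho>1: "1 \<le> \<rho>" by (simp add: \<rho>_def)
    have "x a \<le> \<mu>"
    proof -
      have "sum x {b} \<le> sum x (V - (joint_link \<union> {a, w}))"
        using finV named_vertices joint_link_subset pos by (intro sum_mono2) (auto simp: less_imp_le)
      also have "\<dots> = 1 - sum x (joint_link \<union> {a, w})"
      proof -
        have "joint_link \<union> {a, w} \<subseteq> V" using joint_link_subset AV named_vertices by auto
        from sumR[OF this] show ?thesis by linarith
      qed
      also have "sum x (joint_link \<union> {a, w}) = sum x joint_link + (x a + x w)"
        using named_vertices joint_link_subset finite_joint_link by (subst sum.union_disjoint) auto
      finally show ?thesis using smallest_in_core(1)[of b] abc by (simp add: \<mu>_def)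
    qed
    define W where "W = x w + \<mu> + (\<rho> - 1) * x a"
    have W: "W \<le> 1 - x a - x t" if "t \<in> joint_link" for t
    proof -
      have "real (card (joint_link - {t})) * x a \<le> sum x (joint_link - {t})"
        using xN by (intro sum_bounded_below) auto
      moreover have "real (card (joint_link - {t})) = \<rho> - 1"
        using that finite_joint_link \<open>1 \<le> card joint_link\<close> by (simp add: \<rho>_def of_nat_diff)
      moreover have "sum x (joint_link - {t}) = d - x t" using that finite_joint_link by (simp add: d_def sum_diff)
      ultimately show ?thesis by (simp add: W_def \<mu>_def d_def)
    qed
    have "(x t - x a) * W \<le> \<beta> + x w * \<mu>" if "t \<in> joint_link" for t
    proof -
      have "(x t - x a) * W \<le> (x t - x a) * (1 - x a - x t)"
        using W[OF that] xN[OF that] by (intro mult_left_mono) auto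
      then show ?thesis using up'[OF that] unfolding S by linarith
    qed
    then have "(\<Sum>t\<in>joint_link. (x t - x a) * W) \<le> \<rho> * (\<beta> + x w * \<mu>)"
      unfolding \<rho>_def by (rule sum_bounded_above)
    also have "(\<Sum>t\<in>joint_link. (x t - x a) * W) = (d - \<rho> * x a) * W"
      by (simp add: sum_distrib_right[symmetric] sum_subtractf \<rho>_def d_def)
    finally show False
      by (rule one_outside_arith[OF s \<rho>1 \<open>x a \<le> \<mu>\<close> \<beta>_pos(2) W_def _ low1])
  next
    case False
    then have q2: "2 \<le> real q" using \<open>0 < q\<close> by linarith
    have "S \<le> real q * x a" unfolding S_def q_def using outside_weights(2) by (intro sum_bounded_above) auto
    have "x t \<le> x a + real q * x a + \<beta> / ((real k - 2) * x a)" if t: "t \<in> joint_link" for t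
    proof -
      define y where "y = 1 - x a - x t"
      have t': "t \<in> A" "t \<noteq> a" using t joint_link_subset by auto
      have "real (card (A - {a, t})) * x a \<le> sum x (A - {a, t})"
        using smallest_in_core(1) by (intro sum_bounded_below) auto
      also have "\<dots> \<le> sum x (V - {a, t})"
        using AV finV pos by (intro sum_mono2) (auto simp: less_imp_le)
      also have "\<dots> = y" using sumR[of "{a, t}"] t' AV named_vertices by (auto simp: y_def)
      also have "real (card (A - {a, t})) = real k - 2"
        using t' abc cardA k4 finite_core by (simp add: card_Diff_subset of_nat_diff)
      finally have y: "(real k - 2) * x a \<le> y" .
      have "0 < (real k - 2) * x a" using k4 s by auto
      then have y0: "0 < y" using y by linarith
      have "\<mu> \<le> y"
      proof -
        have "x t \<le> d" unfolding d_def using t finite_joint_link xN by (intro member_le_sum) auto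
        then show ?thesis using s by (simp add: y_def \<mu>_def d_def)
      qed
      moreover have "0 \<le> S" unfolding S_def using pos by (intro sum_nonneg) (auto simp: less_imp_le)
      ultimately have "S * \<mu> \<le> real q * x a * y"
        using \<open>S \<le> real q * x a\<close> y0 s by (smt (verit) mult_left_mono mult_right_mono)
      then have "(x t - x a) * y \<le> \<beta> + real q * x a * y" using up'[OF t] by (simp add: y_def)
      then have "(x t - x a - real q * x a) * y \<le> \<beta>" by (simp add: algebra_simps)
      then have "x t - x a - real q * x a \<le> \<beta> / y" using y0 by (simp add: pos_le_divide_eq)
      also have "\<dots> \<le> \<beta> / ((real k - 2) * x a)"
        using y \<open>0 < (real k - 2) * x a\<close> \<beta>_pos by (intro divide_left_mono) auto
      finally show ?thesis by simp
    qed
    then have "d \<le> \<rho> * (x a + real q * x a + \<beta> / ((real k - 2) * x a))"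
      unfolding d_def \<rho>_def by (rule sum_bounded_above)
    then show False
      using many_outside_arith[OF s _ \<beta>_pos(2) _ _ C q2 ql _ _ low'] k4 three_card_joint_link xN
      by (simp add: \<rho>_def l_def d_def sum_nonneg)
  qed
qed

end

section \<open>Rankings and joint maxima\<close>

lemma rank_ex:
  fixes x :: "'a \<Rightarrow> real"
  assumes "finite V"
  shows "\<exists>\<kappa> :: 'a \<Rightarrow> nat. inj_on \<kappa> V \<and> (\<forall>i\<in>V. \<forall>j\<in>V. \<kappa> i < \<kappa> j \<longrightarrow> x j \<le> x i)"
  using assms
proof (induction V rule: finite_ranking_induct[where f = "\<lambda>i. - x i"])
  case (insert u S)
  obtain \<kappa> :: "'a \<Rightarrow> nat" where \<kappa>: "inj_on \<kappa> S" "\<forall>i\<in>S. \<forall>j\<in>S. \<kappa> i < \<kappa> j \<longrightarrow> x j \<le> x i"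
    using insert.IH by blast
  show ?case
  proof (cases "u \<in> S")
    case True
    then show ?thesis using \<kappa> by (auto simp: insert_absorb)
  next
    case False
    define \<kappa>' where "\<kappa>' = \<kappa>(u := Suc (sum \<kappa> S))"
    have "\<kappa> p \<le> sum \<kappa> S" if "p \<in> S" for p using that insert.hyps(1) by (simp add: member_le_sum)
    then have u: "\<kappa>' p < \<kappa>' u" if "p \<in> S" for p
      using that False by (auto simp: \<kappa>'_def less_Suc_eq_le)
    have S: "\<kappa>' p = \<kappa> p" if "p \<in> S" for p using that False by (auto simp: \<kappa>'_def)
    have "inj_on \<kappa>' S" using \<kappa>(1) S by (simp add: inj_on_def)
    moreover have "\<kappa>' u \<notin> \<kappa>' ` S" using u by force
    ultimately have "inj_on \<kappa>' (insert u S)" by (auto simp: inj_on_insert)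
    moreover have "x j \<le> x i" if ij: "i \<in> insert u S" "j \<in> insert u S" "\<kappa>' i < \<kappa>' j" for i j
    proof (cases "j = u")
      case True
      then show ?thesis using ij insert.hyps(2)[of i] by auto
    next
      case jS: False
      then have "i \<in> S" using ij u[of j] by auto
      then show ?thesis using ij jS \<kappa>(2) S by auto
    qed
    ultimately show ?thesis by blast
  qed
qed simp

lemma last_ex:
  fixes \<kappa> :: "'a \<Rightarrow> nat"
  assumes "finite A" "A \<noteq> {}" "inj_on \<kappa> A"
  obtains a where "a \<in> A" "\<And>p. p \<in> A - {a} \<Longrightarrow> \<kappa> p < \<kappa> a"
proof -
  have "Max (\<kappa> ` A) \<in> \<kappa> ` A" using assms by (intro Max_in) auto
  then obtain a where a: "a \<in> A" "\<kappa> a = Max (\<kappa> ` A)" by auto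
  have "\<kappa> p < \<kappa> a" if "p \<in> A - {a}" for p
  proof -
    have "\<kappa> p \<le> \<kappa> a" using that assms a by simp
    moreover have "\<kappa> p \<noteq> \<kappa> a" using that a(1) inj_onD[OF assms(3), of p a] by auto
    ultimately show ?thesis by simp
  qed
  then show ?thesis using that a by blast
qed

lemma last_three_ex:
  fixes \<kappa> :: "'a \<Rightarrow> nat"
  assumes "finite A" "3 \<le> card A" "inj_on \<kappa> A"
  obtains a b c where "a \<in> A" "b \<in> A" "c \<in> A" "\<kappa> c < \<kappa> b" "\<kappa> b < \<kappa> a"
    "\<And>p. p \<in> A - {a, b, c} \<Longrightarrow> \<kappa> p < \<kappa> c"
proof -
  have inj: "inj_on \<kappa> B" if "B \<subseteq> A" for B using assms(3) that by (rule inj_on_subset)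
  have ne: "B \<noteq> {}" if "1 \<le> card B" for B :: "'a set" using that by auto
  obtain a where a: "a \<in> A" "\<And>p. p \<in> A - {a} \<Longrightarrow> \<kappa> p < \<kappa> a"
    using last_ex[OF assms(1) ne assms(3)] assms(2) by (metis le_trans one_le_numeral)
  have A1: "finite (A - {a})" "2 \<le> card (A - {a})" "inj_on \<kappa> (A - {a})"
    using assms a inj by auto
  obtain b where b: "b \<in> A - {a}" "\<And>p. p \<in> A - {a} - {b} \<Longrightarrow> \<kappa> p < \<kappa> b"
    using last_ex[OF A1(1) ne A1(3)] A1(2) by (metis le_trans one_le_numeral)
  have A2: "finite (A - {a} - {b})" "1 \<le> card (A - {a} - {b})" "inj_on \<kappa> (A - {a} - {b})"
    using A1 b inj[of "A - {a} - {b}"] by auto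
  obtain c where c: "c \<in> A - {a} - {b}" "\<And>p. p \<in> A - {a} - {b} - {c} \<Longrightarrow> \<kappa> p < \<kappa> c"
    using last_ex[OF A2(1) ne A2(3)] A2(2) by metis
  show ?thesis
    by (rule that[of a b c]) (use a b c in auto)
qed

text \<open>For each of the finitely many edge sets the maximum over the weightings is attained, so there is a
pair of an edge set and a weighting that is best among all pairs.\<close>

lemma joint_maximum_ex:
  assumes V: "finite V" "V \<noteq> {}" and \<G>: "\<G> \<subseteq> Pow (nsets V 3)" "\<G> \<noteq> {}"
  obtains E x where "E \<in> \<G>" "x \<in> weightings V"
    "\<And>E' y. E' \<in> \<G> \<Longrightarrow> y \<in> weightings V \<Longrightarrow> edge_weight E' y \<le> edge_weight E x"
proof -
  define \<Lambda> where "\<Lambda> E = lagrangian \<lparr>verts = V, edges = E\<rparr>" for E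
  have att: "\<exists>x\<in>weightings V. edge_weight E x = \<Lambda> E \<and> (\<forall>y\<in>weightings V. edge_weight E y \<le> \<Lambda> E)"
    if "E \<in> \<G>" for E
    using lagrangian_attained[of "\<lparr>verts = V, edges = E\<rparr>"] that V \<G>
    by (auto simp: is_three_graph_def lagrange_poly_def edge_weight_def \<Lambda>_def)
  have "finite \<G>"
    using \<G>(1) V(1) by (meson finite_Pow_iff finite_imp_finite_nsets finite_subset)
  then have "Max (\<Lambda> ` \<G>) \<in> \<Lambda> ` \<G>" using \<G>(2) by (intro Max_in) auto
  then obtain E where E1: "E \<in> \<G>" "\<Lambda> E = Max (\<Lambda> ` \<G>)" by auto
  have E: "E \<in> \<G>" "\<And>E'. E' \<in> \<G> \<Longrightarrow> \<Lambda> E' \<le> \<Lambda> E"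
    using E1 \<open>finite \<G>\<close> by auto
  from att[OF E(1)] obtain x where "x \<in> weightings V" "edge_weight E x = \<Lambda> E" by blast
  then show ?thesis using that E att by (metis order_trans)
qed

lemma insert_in_nsets_3:
  assumes "P \<in> nsets B 2" "u \<notin> B" "insert u B \<subseteq> A"
  shows "insert u P \<in> nsets A 3"
proof -
  have "finite P" "card P = 2" "u \<notin> P" "insert u P \<subseteq> A" using assms by (auto simp: nsets_def)
  then show ?thesis by (simp add: nsets_def)
qed

section \<open>Near-cliques and their modifications\<close>

text \<open>The hypergraph in question has the edge set \<open>nsets A 3 - {e} \<union> F\<close>. The core \<open>A\<close>, the missing
triple \<open>e\<close> and the set \<open>F\<close> of further edges are kept apart, as the same edge set may arise
from different cores.\<close>

definition near_clique :: "nat \<Rightarrow> 'a set \<Rightarrow> 'a set \<Rightarrow> 'a set \<Rightarrow> 'a set set \<Rightarrow> bool" where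
  "near_clique k V A e F \<longleftrightarrow> A \<subseteq> V \<and> card A = k \<and> e \<in> nsets A 3 \<and>
     F \<subseteq> nsets V 3 - nsets A 3 \<and> card F + 2 \<le> (k - 1) choose 2"

lemma edge_weight_near_clique:
  assumes "finite V" "near_clique k V A e F"
  shows "edge_weight (nsets A 3 - {e} \<union> F) x = edge_weight (nsets A 3) x - prod x e + edge_weight F x"
proof -
  have "finite (nsets A 3)" "finite (nsets V 3)"
    using assms by (auto simp: near_clique_def finite_subset intro: finite_imp_finite_nsets)
  moreover have "F \<subseteq> nsets V 3" "(nsets A 3 - {e}) \<inter> F = {}" "e \<in> nsets A 3"
    using assms by (auto simp: near_clique_def)
  ultimately have "finite (nsets A 3)" "finite F" "(nsets A 3 - {e}) \<inter> F = {}" "e \<in> nsets A 3"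
    by (auto intro: finite_subset)
  then show ?thesis unfolding edge_weight_def by (simp add: sum.union_disjoint sum_diff1)
qed

lemma edge_weight_delete_vertex:
  assumes "finite E" "\<And>g. g \<in> E \<Longrightarrow> finite g" "x u = 0"
  shows "edge_weight E x = edge_weight {g \<in> E. u \<notin> g} x"
  unfolding edge_weight_def
  by (rule sum.mono_neutral_right) (use assms in \<open>auto intro: prod_zero\<close>)

lemma edge_weight_mono:
  assumes "E \<subseteq> E'" "finite E'" "\<And>g i. g \<in> E' \<Longrightarrow> i \<in> g \<Longrightarrow> 0 \<le> x i"
  shows "edge_weight E x \<le> edge_weight E' x"
  unfolding edge_weight_def
  by (rule sum_mono2) (use assms in \<open>auto intro: prod_nonneg\<close>)

text \<open>All cliques of the same order with one edge removed are isomorphic, so that one Lagrangian bounds the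
weights of all of them.\<close>

lemma edge_weight_clique_minus_edge_le:
  assumes A: "finite A" "finite A'" "card A = card A'"
    and e: "e \<in> nsets A 3" "e' \<in> nsets A' 3" and x: "x \<in> weightings A'"
  shows "edge_weight (nsets A' 3 - {e'}) x \<le> lagrangian \<lparr>verts = A, edges = nsets A 3 - {e}\<rparr>"
proof -
  have se: "finite e" "finite e'" "e \<subseteq> A" "e' \<subseteq> A'" "card e = card e'"
    using e by (auto simp: nsets_def)
  obtain f where f: "bij_betw f e e'" using se finite_same_card_bij by blast
  have "card (A - e) = card (A' - e')" using se A by (simp add: card_Diff_subset)
  then obtain g where g: "bij_betw g (A - e) (A' - e')"
    using A finite_same_card_bij by (metis finite_Diff)
  define h where "h = (\<lambda>i. if i \<in> e then f i else g i)"
  have "bij_betw h (e \<union> (A - e)) (e' \<union> (A' - e'))"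
    unfolding h_def by (rule bij_betw_disjoint_Un[OF f g]) auto
  then have h: "bij_betw h A A'" using se by (simp add: Un_absorb1)
  have he: "h ` e = e'" using f by (auto simp: h_def bij_betw_def)
  have "bij_betw (image h) (nsets A 3) (nsets A' 3)" using h by (rule bij_betw_nsets)
  then have H: "bij_betw (image h) (nsets A 3 - {e}) (nsets A' 3 - {e'})"
    using e he by (metis bij_betw_DiffI bij_betw_singletonI empty_subsetI insert_subset bij_betw_def inj_on_subset image_insert image_empty)
  have "edge_weight (nsets A' 3 - {e'}) x = (\<Sum>G\<in>nsets A 3 - {e}. prod x (h ` G))"
    unfolding edge_weight_def by (rule sum.reindex_bij_betw[OF H, symmetric])
  also have "\<dots> = (\<Sum>G\<in>nsets A 3 - {e}. prod (x \<circ> h) G)"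
  proof (rule sum.cong)
    fix G assume "G \<in> nsets A 3 - {e}"
    then have "inj_on h G" using h by (auto simp: bij_betw_def nsets_def intro: inj_on_subset)
    then show "prod x (h ` G) = prod (x \<circ> h) G" by (rule prod.reindex)
  qed simp
  also have "\<dots> = lagrange_poly \<lparr>verts = A, edges = nsets A 3 - {e}\<rparr> (x \<circ> h)"
    by (simp add: lagrange_poly_def)
  also have "\<dots> \<le> lagrangian \<lparr>verts = A, edges = nsets A 3 - {e}\<rparr>"
  proof -
    have "sum (x \<circ> h) A = sum x A'" using sum.reindex_bij_betw[OF h, of x] by simp
    then have "x \<circ> h \<in> weightings A"
      using x h by (auto simp: weightings_def bij_betw_def)
    moreover have "A \<noteq> {}" using e(1) by (auto simp: nsets_def)
    ultimately show ?thesis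
      using lagrangian_attained[of "\<lparr>verts = A, edges = nsets A 3 - {e}\<rparr>"] A
      by (auto simp: is_three_graph_def)
  qed
  finally show ?thesis .
qed


text \<open>A vertex \<open>u\<close> of weight \<open>0\<close> may be deleted. If it lies outside the core, what remains is a near-clique
with the same core. If it lies in the core, an outside vertex \<open>v\<close> takes its place: since \<open>F\<close> is
smaller than the number of pairs in the rest of the core, some such pair does not form an edge with
\<open>v\<close>, and this triple becomes the missing one. The remaining triples of the new core are added as
edges, which cannot decrease the weight. In both cases the weight is at most \<open>\<tau>\<close>, by the bound on
fewer vertices.\<close>

lemma positive_joint_maximum:
  fixes x :: "'a \<Rightarrow> real" and \<tau> :: real
  assumes V: "finite V" and k4: "4 \<le> k"
    and smaller: "\<And>u A e F y. u \<in> V \<Longrightarrow> near_clique k (V - {u}) A e F \<Longrightarrow> y \<in> weightings (V - {u}) \<Longrightarrow>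
       edge_weight (nsets A 3 - {e} \<union> F) y \<le> \<tau>"
    and conf: "near_clique k V A e F" "A \<noteq> V" and x: "x \<in> weightings V"
    and big: "\<tau> < edge_weight (nsets A 3 - {e} \<union> F) x"
    and u: "u \<in> V"
  shows "0 < x u"
proof (rule ccontr)
  assume "\<not> 0 < x u"
  then have xu: "x u = 0" using x u by (auto simp: weightings_def intro: antisym)
  let ?E = "nsets A 3 - {e} \<union> F"
  note conf' = conf[unfolded near_clique_def]
  have finA: "finite A" using V conf' finite_subset by blast
  have EV: "?E \<subseteq> nsets V 3" using conf' nsets_mono[of A V 3] by blast
  have finE: "finite ?E" using EV V finite_imp_finite_nsets finite_subset by blast
  have finF: "finite F" using finE by simp
  have E0: "edge_weight ?E x = edge_weight {g \<in> ?E. u \<notin> g} x"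
    using finE EV xu by (intro edge_weight_delete_vertex) (auto simp: nsets_def)
  have "sum x (V - {u}) = 1" using x V u xu by (simp add: weightings_def sum_diff1)
  then have xW: "x \<in> weightings (V - {u})" using x by (auto simp: weightings_def)
  have contra: False if "near_clique k (V - {u}) A' e' F'" "{g \<in> ?E. u \<notin> g} \<subseteq> nsets A' 3 - {e'} \<union> F'" for A' e' F'
  proof -
    let ?E' = "nsets A' 3 - {e'} \<union> F'"
    have "?E' \<subseteq> nsets (V - {u}) 3"
      using that(1) nsets_mono[of A' "V - {u}" 3] unfolding near_clique_def by blast
    then have E'V: "finite ?E'" "\<And>g. g \<in> ?E' \<Longrightarrow> g \<subseteq> V"
      using finite_imp_finite_nsets[of "V - {u}" 3] V finite_subset
      by (blast, unfold nsets_def, blast)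
    have "edge_weight {g \<in> ?E. u \<notin> g} x \<le> edge_weight ?E' x"
    proof (rule edge_weight_mono[OF that(2) E'V(1)])
      fix g i assume "g \<in> ?E'" "i \<in> g"
      then have "i \<in> V" using E'V(2) by blast
      then show "0 \<le> x i" using x by (simp add: weightings_def)
    qed
    also have "\<dots> \<le> \<tau>" by (rule smaller[OF u that(1) xW])
    finally show False using big E0 by linarith
  qed
  show False
  proof (cases "u \<in> A")
    case False
    show False
    proof (rule contra)
      have "card {g \<in> F. u \<notin> g} \<le> card F" using finF by (intro card_mono) auto
      then show "near_clique k (V - {u}) A e {g \<in> F. u \<notin> g}"
        using conf' False unfolding near_clique_def by (auto simp: nsets_def)
    qed auto
  next
    case True
    obtain v where v: "v \<in> V" "v \<notin> A" using conf(2) conf' by blast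
    let ?A = "insert v (A - {u})"
    let ?F = "{g \<in> F. u \<notin> g \<and> \<not> g \<subseteq> ?A}"
    have "inj_on (insert v) (nsets (A - {u}) 2)"
      using v by (auto simp: inj_on_def nsets_def insert_ident subset_iff)
    then have "card (insert v ` nsets (A - {u}) 2) = (k - 1) choose 2"
      using True conf' finA by (simp add: card_image)
    then have "card F < card (insert v ` nsets (A - {u}) 2)" using conf' by simp
    then have "\<not> insert v ` nsets (A - {u}) 2 \<subseteq> F" using card_mono[OF finF] by (meson not_le)
    then obtain P where P: "P \<in> nsets (A - {u}) 2" "insert v P \<notin> F" by blast
    have vP: "insert v P \<in> nsets ?A 3" "insert v P \<notin> nsets A 3"
      using P v by (auto intro: insert_in_nsets_3) (auto simp: nsets_def)
    show False
    proof (rule contra)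
      have "card ?F \<le> card F" using finF by (intro card_mono) auto
      moreover have "card ?A = k" using True conf' finA v k4 by (simp add: card_insert_if)
      ultimately show "near_clique k (V - {u}) ?A (insert v P) ?F"
        using conf' vP v True unfolding near_clique_def by (auto simp: nsets_def)
      show "{g \<in> ?E. u \<notin> g} \<subseteq> nsets ?A 3 - {insert v P} \<union> ?F"
      proof
        fix g assume "g \<in> {g \<in> ?E. u \<notin> g}"
        then have g: "g \<in> ?E" "u \<notin> g" by auto
        show "g \<in> nsets ?A 3 - {insert v P} \<union> ?F"
        proof (cases "g \<subseteq> ?A")
          case True
          have "g \<in> nsets V 3" using EV g(1) by blast
          then have "g \<in> nsets ?A 3" using True by (simp add: nsets_def)
          moreover have "g \<noteq> insert v P" using g(1) vP(2) P(2) by blast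
          ultimately show ?thesis by blast
        next
          case False
          then have "g \<notin> nsets A 3" using g(2) by (auto simp: nsets_def)
          then show ?thesis using g False by blast
        qed
      qed
    qed
  qed
qed

lemma near_clique_edge_exchange:
  fixes x :: "'a \<Rightarrow> real"
  assumes V: "finite V" and conf: "near_clique k V A e F"
    and e': "e' \<in> nsets A 3" "prod x e' \<le> prod x e"
  shows "near_clique k V A e' F"
    "edge_weight (nsets A 3 - {e} \<union> F) x \<le> edge_weight (nsets A 3 - {e'} \<union> F) x"
proof -
  show *: "near_clique k V A e' F" using conf e' by (simp add: near_clique_def)
  show "edge_weight (nsets A 3 - {e} \<union> F) x \<le> edge_weight (nsets A 3 - {e'} \<union> F) x"
    using edge_weight_near_clique[OF V conf, of x] edge_weight_near_clique[OF V *, of x] e' by simp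
qed

text \<open>Suppose that \<open>v\<close> is heavier than \<open>a\<close>. Let \<open>v\<close> replace \<open>a\<close> in the core and exchange \<open>a\<close> and \<open>v\<close> in the
edges that lie inside \<open>A \<union> {v}\<close> and contain exactly one of them. The weight changes by \<open>x v - x a\<close>
times the weight of the pairs that form an edge with \<open>a\<close> but not with \<open>v\<close>, where \<open>b c\<close> counts
against this if it forms an edge with \<open>v\<close>. At least two core pairs do not form an edge with \<open>v\<close>, and
\<open>b c\<close> is the lightest pair; so the change is positive.\<close>

lemma near_clique_core_heaviest:
  fixes x :: "'a \<Rightarrow> real"
  assumes V: "finite V" and conf: "near_clique k V A {a, b, c} F"
    and pos: "\<And>i. i \<in> V \<Longrightarrow> 0 < x i"
    and max: "\<And>A' e' F'. near_clique k V A' e' F' \<Longrightarrow>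
      edge_weight (nsets A' 3 - {e'} \<union> F') x \<le> edge_weight (nsets A 3 - {{a, b, c}} \<union> F) x"
    and abc: "a \<in> A" "b \<in> A" "c \<in> A" "a \<noteq> b" "a \<noteq> c" "b \<noteq> c"
    and small: "\<And>p. p \<in> A - {a} \<Longrightarrow> x b \<le> x p" "\<And>p. p \<in> A - {a, b} \<Longrightarrow> x c \<le> x p"
    and v: "v \<in> V - A"
  shows "x v \<le> x a"
proof (rule ccontr)
  assume "\<not> x v \<le> x a"
  then have va: "x a < x v" by simp
  note conf' = conf[unfolded near_clique_def]
  define B where "B = A - {a}"
  have B: "A = insert a B" "a \<notin> B" "v \<notin> B" "v \<noteq> a" "b \<in> B" "c \<in> B" "B \<subseteq> V"
    using abc v conf' by (auto simp: B_def)
  have finB: "finite B" using B(7) V finite_subset by blast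
  have finB2: "finite (nsets B 2)" using finB by (rule finite_imp_finite_nsets)
  have F: "F \<subseteq> nsets V 3" "F \<inter> nsets A 3 = {}" using conf' by auto
  have finF: "finite F" using F V finite_imp_finite_nsets finite_subset by blast
  define L where "L = {P \<in> nsets B 2. insert v P \<in> F}"
  have LB: "L \<subseteq> nsets B 2" by (auto simp: L_def)
  have finL: "finite L" using LB finB2 finite_subset by blast
  have inj: "inj_on (insert u) (nsets B 2)" if "u \<notin> B" for u
    using that by (auto simp: inj_on_def nsets_def insert_ident subset_iff)
  have injL: "inj_on (insert u) L" if "u \<notin> B" for u
    using inj[OF that] LB by (rule inj_on_subset)
  have W: "edge_weight (insert u ` M) x = x u * edge_weight M x" if "M \<subseteq> nsets B 2" "u \<notin> B" for u M
  proof -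
    have "edge_weight (insert u ` M) x = (\<Sum>P\<in>M. prod x (insert u P))"
      unfolding edge_weight_def
      using inj_on_subset[OF inj[OF that(2)] that(1)] by (simp add: sum.reindex)
    also have "\<dots> = (\<Sum>P\<in>M. x u * prod x P)"
    proof (rule sum.cong)
      fix P assume "P \<in> M"
      then have "finite P" "u \<notin> P" using that by (auto simp: nsets_def)
      then show "prod x (insert u P) = x u * prod x P" by simp
    qed simp
    finally show ?thesis by (simp add: edge_weight_def sum_distrib_left)
  qed
  have W3: "edge_weight (nsets (insert u B) 3) x = edge_weight (nsets B 3) x + x u * edge_weight (nsets B 2) x"
    if "u \<notin> B" for u
    using W[OF subset_refl that] sum_nsets_insert[OF finB that, of "prod x" 2] inj[OF that]
    by (simp add: edge_weight_def sum.reindex numeral_3_eq_3 numeral_2_eq_2)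
  define F' where "F' = (F - insert v ` L) \<union> insert a ` L"
  have dis: "(F - insert v ` L) \<inter> insert a ` L = {}"
  proof -
    have "insert a ` L \<subseteq> nsets A 3" using LB B(1,2) by (auto intro: insert_in_nsets_3)
    then show ?thesis using F by blast
  qed
  have vL: "insert v ` L \<subseteq> F" by (auto simp: L_def)
  have cardF': "card F' \<le> card F"
  proof -
    have "card F' = card (F - insert v ` L) + card (insert a ` L)"
      unfolding F'_def using dis finF finL by (intro card_Un_disjoint) auto
    also have "card (insert a ` L) = card (insert v ` L)"
      using injL B by (simp add: card_image)
    also have "card (F - insert v ` L) = card F - card (insert v ` L)"
      using vL finL by (intro card_Diff_subset) auto
    finally show ?thesis using card_mono[OF finF vL] by simp
  qed
  have conf2: "near_clique k V (insert v B) {v, b, c} F'"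
    unfolding near_clique_def
  proof (intro conjI)
    show "insert v B \<subseteq> V" using B v by auto
    show "card (insert v B) = k" using B finB conf' by simp
    show "{v, b, c} \<in> nsets (insert v B) 3"
      using B abc by (intro insert_in_nsets_3[of "{b, c}" B]) auto
    show "card F' + 2 \<le> (k - 1) choose 2" using cardF' conf' by simp
    show "F' \<subseteq> nsets V 3 - nsets (insert v B) 3"
    proof
      fix g assume g: "g \<in> F'"
      show "g \<in> nsets V 3 - nsets (insert v B) 3"
      proof (cases "g \<in> insert a ` L")
        case True
        then obtain P where P: "g = insert a P" "P \<in> nsets B 2" using LB by blast
        have "insert a B \<subseteq> V" using B(1) conf' by blast
        then have "g \<in> nsets V 3" using P B(2) by (auto intro: insert_in_nsets_3)
        moreover have "\<not> g \<subseteq> insert v B" using P(1) B(2,4) by blast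
        ultimately show ?thesis by (simp add: nsets_def)
      next
        case False
        then have g: "g \<in> F" "g \<notin> insert v ` L" using g by (auto simp: F'_def)
        have "g \<notin> nsets (insert v B) 3"
        proof
          assume g3: "g \<in> nsets (insert v B) 3"
          show False
          proof (cases "v \<in> g")
            case True
            then have "g = insert v (g - {v})" "g - {v} \<in> nsets B 2" using g3 by (auto simp: nsets_def)
            then show False using g by (metis (no_types, lifting) L_def image_eqI mem_Collect_eq)
          next
            case False
            then have "g \<in> nsets A 3" using g3 B by (auto simp: nsets_def)
            then show False using g F by blast
          qed
        qed
        then show ?thesis using g F by blast
      qed
    qed
  qed
  have wF': "edge_weight F' x = edge_weight F x - x v * edge_weight L x + x a * edge_weight L x"
  proof -
    have "edge_weight F' x = edge_weight (F - insert v ` L) x + edge_weight (insert a ` L) x"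
      unfolding F'_def edge_weight_def using dis finF finL by (intro sum.union_disjoint) auto
    also have "edge_weight (F - insert v ` L) x = edge_weight F x - edge_weight (insert v ` L) x"
      unfolding edge_weight_def using vL finF by (intro sum_diff) auto
    finally show ?thesis using W[OF LB] B by simp
  qed
  have "edge_weight (nsets (insert v B) 3 - {{v, b, c}} \<union> F') x \<le> edge_weight (nsets A 3 - {{a, b, c}} \<union> F) x"
    by (rule max[OF conf2])
  moreover have "prod x {v, b, c} = x v * (x b * x c)" "prod x {a, b, c} = x a * (x b * x c)"
  proof -
    have "v \<noteq> b" "v \<noteq> c" using B by auto
    then show "prod x {v, b, c} = x v * (x b * x c)" using abc by simp
  qed (use abc in simp)
  ultimately have "(x v - x a) * (edge_weight (nsets B 2) x - edge_weight L x - x b * x c) \<le> 0"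
    unfolding edge_weight_near_clique[OF V conf] edge_weight_near_clique[OF V conf2] wF'
    using W3[of a] W3[of v] B(1-3) by (simp add: algebra_simps del: prod.insert)
  then have le: "edge_weight (nsets B 2) x - edge_weight L x \<le> x b * x c"
    using va by (simp add: mult_le_0_iff)
  have "x b * x c \<le> prod x P" if P: "P \<in> nsets B 2" for P
  proof -
    obtain p q where pq: "P = {p, q}" "p \<in> A - {a}" "q \<in> A - {a}" "p \<noteq> q"
      using P by (auto simp: nsets_2_eq B_def)
    have *: "x b * x c \<le> x p * x q" if "p \<in> A - {a}" "q \<in> A - {a, b}" for p q
    proof (rule mult_mono)
      show "x b \<le> x p" "x c \<le> x q" using small that by blast+
      have "p \<in> V" "c \<in> V" using that(1) B(6,7) by (auto simp: B_def)
      then show "0 \<le> x p" "0 \<le> x c" using pos less_imp_le by blast+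
    qed
    then show ?thesis using pq *[of p q] *[of q p] by (auto simp: mult.commute)
  qed
  then have "real (card (nsets B 2 - L)) * (x b * x c) \<le> (\<Sum>P\<in>nsets B 2 - L. prod x P)"
    by (intro sum_bounded_below) auto
  also have "\<dots> = edge_weight (nsets B 2) x - edge_weight L x"
    unfolding edge_weight_def using finB2 LB by (rule sum_diff)
  also note le
  finally have "real (card (nsets B 2 - L)) * (x b * x c) \<le> x b * x c" .
  moreover have "0 < x b * x c"
    using B(5-7) by (intro mult_pos_pos pos) auto
  ultimately have "real (card (nsets B 2 - L)) \<le> 1"
    using mult_le_cancel_right_pos[of "x b * x c" _ 1] by simp
  then have "card (nsets B 2 - L) \<le> 1" by simp
  moreover have "card (nsets B 2 - L) = card (nsets B 2) - card L"
    using finL LB by (rule card_Diff_subset)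
  moreover have "card (nsets B 2) = (k - 1) choose 2" using B finB conf' by auto
  moreover have "card L \<le> card F"
    using card_mono[OF finF vL] injL[of v] B by (simp add: card_image)
  ultimately show False using conf' by linarith
qed


section \<open>The Lagrangian of a near-clique\<close>

text \<open>A near-clique weighs no more than a clique of the order of its core with one edge removed. The proof
takes a joint maximum over all near-cliques on \<open>V\<close>. Without losing maximality, the missing triple is
made as light as possible; this puts the core before the other vertices in the order of weights,
and then \<open>F\<close> is compressed. The result is a \<open>shifted_equilibrium\<close>.\<close>

lemma near_clique_edge_weight_le:
  fixes x :: "'a \<Rightarrow> real"
  assumes k4: "4 \<le> k"
    and \<tau>: "\<And>(A :: 'a set) e y. finite A \<Longrightarrow> card A = k \<Longrightarrow> e \<in> nsets A 3 \<Longrightarrow> y \<in> weightings A \<Longrightarrow>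
       edge_weight (nsets A 3 - {e}) y \<le> (\<tau> :: real)"
  shows "finite V \<Longrightarrow> near_clique k V A e F \<Longrightarrow> x \<in> weightings V \<Longrightarrow>
     edge_weight (nsets A 3 - {e} \<union> F) x \<le> \<tau>"
proof (induction "card V" arbitrary: V A e F x rule: less_induct)
  case less
  note V = less.prems(1)
  have smaller: "edge_weight (nsets A 3 - {e} \<union> F) y \<le> \<tau>"
    if "u \<in> V" "near_clique k (V - {u}) A e F" "y \<in> weightings (V - {u})" for u A e F y
  proof (rule less.hyps[OF _ _ that(2,3)])
    show "card (V - {u}) < card V" using V that(1) by (rule card_Diff1_less)
    show "finite (V - {u})" using V by simp
  qed
  show ?case
  proof (rule ccontr)
    assume big0: "\<not> edge_weight (nsets A 3 - {e} \<union> F) x \<le> \<tau>"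
    define \<G> where "\<G> = {nsets A 3 - {e} \<union> F | A e F. near_clique k V A e F}"
    have "\<G> \<subseteq> Pow (nsets V 3)"
      using nsets_mono[of _ V 3] unfolding \<G>_def near_clique_def by blast
    moreover have E0: "nsets A 3 - {e} \<union> F \<in> \<G>" using less.prems(2) by (auto simp: \<G>_def)
    moreover have "V \<noteq> {}" using less.prems(3) by (auto simp: weightings_def)
    ultimately obtain E y where Ey: "E \<in> \<G>" "y \<in> weightings V"
      "\<And>E' z. E' \<in> \<G> \<Longrightarrow> z \<in> weightings V \<Longrightarrow> edge_weight E' z \<le> edge_weight E y"
      using joint_maximum_ex[OF V, of \<G>] by (metis empty_iff)
    obtain A0 e0 F0 where conf0: "near_clique k V A0 e0 F0" and E: "E = nsets A0 3 - {e0} \<union> F0"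
      using Ey(1) by (auto simp: \<G>_def)
    have max: "edge_weight (nsets A' 3 - {e'} \<union> F') z \<le> edge_weight E y"
      if "near_clique k V A' e' F'" "z \<in> weightings V" for A' e' F' z
    proof (rule Ey(3)[OF _ that(2)])
      show "nsets A' 3 - {e'} \<union> F' \<in> \<G>" using that(1) unfolding \<G>_def by blast
    qed
    have big: "\<tau> < edge_weight (nsets A0 3 - {e0} \<union> F0) y"
      using Ey(3)[OF E0 less.prems(3)] big0 unfolding E by linarith
    note conf0' = conf0[unfolded near_clique_def]
    have A0V: "A0 \<noteq> V"
    proof
      assume "A0 = V"
      then have "F0 = {}" using conf0' by blast
      then show False using big \<tau>[of V e0 y] \<open>A0 = V\<close> conf0' V Ey(2) by simp
    qed
    have pos: "0 < y i" if "i \<in> V" for i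
      by (rule positive_joint_maximum[OF V k4 smaller conf0 A0V Ey(2) big that])
    have finA: "finite A0" using V conf0' finite_subset by blast

    obtain \<kappa>0 :: "'a \<Rightarrow> nat" where \<kappa>0: "inj_on \<kappa>0 V" "\<And>i j. i \<in> V \<Longrightarrow> j \<in> V \<Longrightarrow> \<kappa>0 i < \<kappa>0 j \<Longrightarrow> y j \<le> y i"
      using rank_ex[OF V, of y] by blast
    have inj0: "inj_on \<kappa>0 A0" using \<kappa>0(1) conf0' inj_on_subset by blast
    have c3: "3 \<le> card A0" using conf0' k4 by simp
    obtain a b c where abc: "a \<in> A0" "b \<in> A0" "c \<in> A0" "\<kappa>0 c < \<kappa>0 b" "\<kappa>0 b < \<kappa>0 a"
      and last3: "\<And>p. p \<in> A0 - {a, b, c} \<Longrightarrow> \<kappa>0 p < \<kappa>0 c"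
      by (rule last_three_ex[OF finA c3 inj0]) (rule that)
    have ne: "a \<noteq> b" "a \<noteq> c" "b \<noteq> c" using abc by auto
    have AV: "p \<in> V" if "p \<in> A0" for p using that conf0' by blast
    have c_le: "y c \<le> y p" if "p \<in> A0 - {a, b}" for p
      using that last3[of p] \<kappa>0(2)[of p c] AV abc by (cases "p = c") auto
    have b_le: "y b \<le> y p" if "p \<in> A0 - {a}" for p
      using that c_le[of p] \<kappa>0(2)[of c b] AV abc by (cases "p = b") auto
    have a_le: "y a \<le> y p" if "p \<in> A0" for p
      using that b_le[of p] \<kappa>0(2)[of b a] AV abc by (cases "p = a") auto
    have abc3: "{a, b, c} \<in> nsets A0 3" using abc ne by (auto simp: nsets_def)
    have "prod y {a, b, c} \<le> prod y e0"
    proof -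
      have e0: "e0 \<subseteq> A0" "finite e0" "card e0 = 3" using conf0' by (auto simp: nsets_def)
      \<comment> \<open>Both triples are sorted by rank and compared vertex by vertex.\<close>
      have e0': "3 \<le> card e0" "inj_on \<kappa>0 e0" using inj0 e0 inj_on_subset by auto
      obtain p q r where pqr: "p \<in> e0" "q \<in> e0" "r \<in> e0" "\<kappa>0 r < \<kappa>0 q" "\<kappa>0 q < \<kappa>0 p"
        by (rule last_three_ex[OF e0(2) e0']) (rule that)
      have ne': "p \<noteq> q" "p \<noteq> r" "q \<noteq> r" using pqr by auto
      then have "card {p, q, r} = card e0" using e0 by simp
      then have e0_eq: "e0 = {p, q, r}" using pqr e0(2) card_subset_eq[of e0 "{p, q, r}"] by auto
      have A0': "p \<in> A0" "q \<in> A0" "r \<in> A0" using pqr e0 by auto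
      have le_a: "\<kappa>0 i \<le> \<kappa>0 a" "i \<noteq> a \<Longrightarrow> \<kappa>0 i \<le> \<kappa>0 b" if "i \<in> A0" for i
        using last3[of i] abc that by (cases "i = b"; cases "i = c"; force)+
      have "q \<noteq> a" using le_a(1)[OF A0'(1)] pqr by auto
      moreover have "r \<noteq> a" using le_a(1)[OF A0'(2)] pqr by auto
      moreover have "r \<noteq> b" using le_a(2)[OF A0'(2)] \<open>q \<noteq> a\<close> pqr by auto
      ultimately have "y a \<le> y p" "y b \<le> y q" "y c \<le> y r"
        using a_le b_le c_le A0' by auto
      then have "y a * (y b * y c) \<le> y p * (y q * y r)"
        using pos AV A0' abc by (intro mult_mono) (auto simp: less_imp_le)
      then show ?thesis unfolding e0_eq using ne ne' by simp
    qed
    note ex = near_clique_edge_exchange[OF V conf0 abc3 this]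
    let ?K = "nsets A0 3 - {{a, b, c}}"
    have Emax: "edge_weight E y \<le> edge_weight (?K \<union> F0) y" using ex(2) E by simp
    have a_top: "y v \<le> y a" if "v \<in> V - A0" for v
      by (rule near_clique_core_heaviest[OF V ex(1) pos _ abc(1-3) ne b_le c_le that])
        (assumption | rule order_trans[OF max[OF _ Ey(2)] Emax])+

    \<comment> \<open>The summand moves the outside vertices behind the core and keeps their order.\<close>
    define \<kappa> where "\<kappa> p = (if p \<in> A0 then \<kappa>0 p else \<kappa>0 p + Suc (sum \<kappa>0 A0))" for p
    have \<kappa>_A: "\<kappa> p = \<kappa>0 p" if "p \<in> A0" for p using that by (simp add: \<kappa>_def)
    have \<kappa>_out: "\<kappa> i < \<kappa> j" if "i \<in> A0" "j \<in> V - A0" for i j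
      using that member_le_sum[of i A0 \<kappa>0] finA by (simp add: \<kappa>_def less_Suc_eq_le trans_le_add2)
    have \<kappa>_inj: "inj_on \<kappa> V"
    proof (rule inj_onI)
      fix i j assume ij: "i \<in> V" "j \<in> V" "\<kappa> i = \<kappa> j"
      then have "i \<in> A0 \<longleftrightarrow> j \<in> A0" using \<kappa>_out[of i j] \<kappa>_out[of j i] by auto
      then have "\<kappa>0 i = \<kappa>0 j" using ij(3) by (auto simp: \<kappa>_def)
      then show "i = j" using \<kappa>0(1) ij by (auto dest: inj_onD)
    qed
    have \<kappa>_anti: "y j \<le> y i" if "i \<in> V" "j \<in> V" "\<kappa> i < \<kappa> j" for i j
    proof (cases "i \<in> A0 \<longleftrightarrow> j \<in> A0")
      case True
      then show ?thesis using that \<kappa>0(2) by (auto simp: \<kappa>_def)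
    next
      case False
      then have "i \<in> A0" "j \<in> V - A0" using that \<kappa>_out[of j i] by auto
      then show ?thesis using a_le[of i] a_top[of j] by linarith
    qed
    have "V - A0 \<noteq> {}" using A0V conf0' by blast
    moreover have "inj_on \<kappa> (V - A0)" using \<kappa>_inj inj_on_subset by blast
    ultimately obtain w where w: "w \<in> V - A0" "\<And>p. p \<in> V - A0 - {w} \<Longrightarrow> \<kappa> p < \<kappa> w"
      using last_ex[of "V - A0" \<kappa>] V by blast
    have w_last: "\<kappa> p \<le> \<kappa> w" if "p \<in> V" for p
      using w \<kappa>_out[of p w] that by (cases "p \<in> A0"; cases "p = w") (auto simp: less_imp_le)

    \<comment> \<open>Among the optimal choices of \<open>F\<close>, one with the least total rank is compressed.\<close>
    define \<Phi> where "\<Phi> F = (\<Sum>g\<in>F. sum \<kappa> g)" for F :: "'a set set"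
    define OK where "OK F \<longleftrightarrow> near_clique k V A0 {a, b, c} F \<and> edge_weight E y \<le> edge_weight (?K \<union> F) y" for F
    have "OK F0" using ex(1) Emax by (simp add: OK_def)
    from ex_has_least_nat[of OK, OF this, of \<Phi>] obtain F1 where F1: "OK F1" "\<And>F. OK F \<Longrightarrow> \<Phi> F1 \<le> \<Phi> F"
      by blast
    have conf1: "near_clique k V A0 {a, b, c} F1" and max1: "edge_weight E y \<le> edge_weight (?K \<union> F1) y"
      using F1(1) by (auto simp: OK_def)
    note conf1' = conf1[unfolded near_clique_def]
    have F1V: "F1 \<subseteq> nsets V 3" "F1 \<inter> nsets A0 3 = {}" using conf1' by auto
    have finF1: "finite F1" using F1V V finite_imp_finite_nsets finite_subset by blast
    have shift: "insert i P \<in> F1"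
      if sh: "insert j P \<in> F1" "j \<notin> P" "i \<notin> P" "i \<in> V" "\<kappa> i < \<kappa> j" "\<not> insert i P \<subseteq> A0" for i j P
    proof (rule ccontr)
      assume notin: "insert i P \<notin> F1"
      define F2 where "F2 = insert (insert i P) (F1 - {insert j P})"
      have "insert j P \<in> nsets V 3" using sh(1) F1V by blast
      then have P: "finite P" "card P = 2" "P \<subseteq> V" "j \<in> V" using sh(2) by (auto simp: nsets_def)
      have "insert i P \<in> nsets V 3" "insert i P \<notin> nsets A0 3"
        using P sh by (auto simp: nsets_def)
      moreover have "card F2 = card F1"
        unfolding F2_def using finF1 notin sh(1) card_gt_0_iff[of F1] by (auto simp: card_insert_if)
      ultimately have conf2: "near_clique k V A0 {a, b, c} F2"
        using conf1' unfolding near_clique_def F2_def by auto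
      have upd: "(\<Sum>g\<in>F2. \<phi> g) + \<phi> (insert j P) = (\<Sum>g\<in>F1. \<phi> g) + \<phi> (insert i P)"
        for \<phi> :: "'a set \<Rightarrow> 'b::comm_monoid_add"
        unfolding F2_def using finF1 notin sh(1) sum.remove[OF finF1 sh(1), of \<phi>]
        by (simp add: ac_simps)
      have "y j * prod y P \<le> y i * prod y P"
        using \<kappa>_anti[OF sh(4) P(4) sh(5)] pos P(3)
        by (intro mult_right_mono prod_nonneg) (auto simp: less_imp_le)
      then have "edge_weight F1 y \<le> edge_weight F2 y"
        using upd[of "prod y"] sh P by (simp add: edge_weight_def)
      then have "OK F2"
        using conf2 max1 edge_weight_near_clique[OF V conf1, of y] edge_weight_near_clique[OF V conf2, of y]
        by (simp add: OK_def)
      then have "\<Phi> F1 \<le> \<Phi> F2" by (rule F1(2))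
      then show False using upd[of "sum \<kappa>"] sh P by (simp add: \<Phi>_def)
    qed
    have bal: "balanced V (?K \<union> F1) y"
    proof (rule balanced_if_optimal[OF V _ Ey(2) pos])
      show "?K \<union> F1 \<subseteq> nsets V 3" using F1V conf1' nsets_mono[of A0 V 3] by blast
      show "edge_weight (?K \<union> F1) z \<le> edge_weight (?K \<union> F1) y" if "z \<in> weightings V" for z
        using max[OF conf1 that] max1 by linarith
    qed
    interpret shifted_equilibrium V A0 F1 y \<kappa> a b c w k
    proof
      show "sum y V = 1" using Ey(2) by (simp add: weightings_def)
      show "\<kappa> c < \<kappa> b" "\<kappa> b < \<kappa> a" using abc by (simp_all add: \<kappa>_A)
      show "\<kappa> p < \<kappa> c" if "p \<in> A0 - {a, b, c}" for p using that last3 abc by (simp add: \<kappa>_A)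
    qed (use V k4 conf1' pos \<kappa>_inj \<kappa>_anti \<kappa>_out abc w w_last shift bal in \<open>auto\<close>)
    show False by (rule contradiction)
  qed
qed


text \<open>The core of \<open>H\<close> without the missing triple has the Lagrangian that bounds all near-cliques with
a core of this order, in particular \<open>H\<close> itself. It is a proper subgraph, as it has fewer than \<open>m\<close>
edges.\<close>

theorem theorem4p1:
  fixes m t n :: nat and H :: "nat three_graph"
  assumes "m > 0" and "t \<ge> 5"
    and "(t - 1) choose 3 \<le> m"
    and "m \<le> ((t - 1) choose 3) + ((t - 2) choose 2) - 3"
    and "is_three_graph H" and "verts H = {1..n}"
    and "card (edges H) = m"
    and "card (nsets {1..t - 1} 3 - edges H) = 1"
    and "\<not> contains_clique H (t - 1)"
  shows "\<not> dense_three_graph H"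
proof
  assume dense: "dense_three_graph H"
  define k where "k = t - 1"
  define A where "A = {1..k}"
  define F where "F = edges H - nsets A 3"
  have k4: "4 \<le> k" and cA: "card A = k" and finA: "finite A" "finite (nsets A 3)"
    using assms(2) by (auto simp: k_def A_def intro: finite_imp_finite_nsets)
  obtain e where e: "nsets A 3 - edges H = {e}"
    using assms(8) by (auto simp: k_def A_def card_1_singleton_iff)
  have eA: "e \<in> nsets A 3" using e by blast
  have V: "finite (verts H)" "edges H \<subseteq> nsets (verts H) 3"
    using assms(5) by (auto simp: is_three_graph_def)
  have finE: "finite (edges H)" using V finite_imp_finite_nsets finite_subset by blast
  have EH: "edges H = nsets A 3 - {e} \<union> F" using e by (auto simp: F_def)
  \<comment> \<open>Each core vertex lies in at least three core triples, and only one of them is not an edge.\<close>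
  have AV: "A \<subseteq> verts H"
  proof
    fix i assume i: "i \<in> A"
    have "nsets (A - {i}) 2 \<noteq> {}" "card (nsets (A - {i}) 2) = (k - 1) choose 2"
      using i finA cA k4 by (auto simp: nsets_eq_empty_iff)
    moreover have "(3::nat) choose 2 \<le> (k - 1) choose 2" using k4 by (intro binomial_right_mono) auto
    ultimately have "2 \<le> card (nsets (A - {i}) 2)" by (simp add: choose_two)
    have "inj_on (insert i) (nsets (A - {i}) 2)"
      by (auto simp: inj_on_def nsets_def insert_ident subset_iff)
    then have "card (insert i ` nsets (A - {i}) 2) = card (nsets (A - {i}) 2)"
      by (rule card_image)
    then have "\<not> insert i ` nsets (A - {i}) 2 \<subseteq> {e}"
      using \<open>2 \<le> card (nsets (A - {i}) 2)\<close> card_mono[of "{e}" "insert i ` nsets (A - {i}) 2"]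
      by auto
    then obtain P where P: "P \<in> nsets (A - {i}) 2" "insert i P \<noteq> e" by blast
    have "insert i P \<in> nsets A 3" using P(1) i by (auto intro: insert_in_nsets_3)
    then have "insert i P \<in> edges H" using P(2) e by (metis DiffI singletonD)
    then have "insert i P \<in> nsets (verts H) 3" using V(2) by blast
    then show "i \<in> verts H" by (simp add: nsets_def)
  qed
  have cK: "card (nsets A 3 - {e}) = (k choose 3) - 1" using eA finA cA by simp
  have k3: "0 < k choose 3" using k4 by simp
  have "card (edges H) = card (nsets A 3 - {e}) + card F"
    unfolding EH using finA finE by (intro card_Un_disjoint) (auto simp: F_def)
  then have cF: "m + 1 = (k choose 3) + card F" using cK k3 assms(7) by simp
  have k2: "3 \<le> (k - 1) choose 2"
    using binomial_right_mono[of 3 "k - 1" 2] k4 by (simp add: choose_two)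
  have mle: "m \<le> (k choose 3) + ((k - 1) choose 2) - 3"
    using assms(4) by (simp add: k_def numeral_2_eq_2)
  have conf: "near_clique k (verts H) A e F"
    unfolding near_clique_def
  proof (intro conjI)
    show "card F + 2 \<le> (k - 1) choose 2" using cF k2 mle by linarith
    show "F \<subseteq> nsets (verts H) 3 - nsets A 3" using V(2) unfolding F_def by blast
  qed (fact AV cA eA)+
  define K where "K = \<lparr>verts = A, edges = nsets A 3 - {e}\<rparr>"
  have "subgraph_of K H"
    using AV EH assms(5) finA(1) by (auto simp: subgraph_of_def K_def is_three_graph_def)
  moreover have "K \<noteq> H"
  proof
    assume "K = H"
    then have "card (edges H) = (k choose 3) - 1" using cK by (auto simp: K_def)
    moreover have "k choose 3 \<le> m" using assms(3) by (simp only: k_def)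
    ultimately show False using assms(7) k3 by linarith
  qed
  moreover have "verts K \<noteq> {}" using k4 by (simp add: K_def A_def)
  ultimately have less: "lagrangian K < lagrangian H"
    using dense by (auto simp: dense_three_graph_def)
  have "verts H \<noteq> {}" using AV k4 by (auto simp: A_def)
  then obtain x where x: "x \<in> weightings (verts H)" "lagrange_poly H x = lagrangian H"
    using lagrangian_attained[OF assms(5)] by blast
  have "edge_weight (nsets A 3 - {e} \<union> F) x \<le> lagrangian K"
  proof (rule near_clique_edge_weight_le[OF k4 _ V(1) conf x(1)])
    show "edge_weight (nsets A' 3 - {e'}) y \<le> lagrangian K"
      if "finite A'" "card A' = k" "e' \<in> nsets A' 3" "y \<in> weightings A'" for A' :: "nat set" and e' y
      using edge_weight_clique_minus_edge_le[OF finA(1) that(1) _ eA that(3,4)] cA that(2)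
      by (simp add: K_def)
  qed
  then have "lagrangian H \<le> lagrangian K"
    using x(2) EH by (simp add: lagrange_poly_def edge_weight_def)
  then show False using less by simp
qed

end
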